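(* Let $f,g,F=f+g$ be as in the context, and let $\{(x^k,y^k)\}_{k\in\mathbb N}$ be a sequence generated by the line-search based variable metric inexact proximal gradient (VMiPG) method described in the context. Suppose that the sequence $\{x^k\}_{k\in\mathbb N}$ is bounded, that there is a constant $\overline\mu>0$ such that $\|\mathcal G_k\|\le\overline\mu$ for all $k\in\mathbb N$, and that for a certain $\gamma\in(0,1/\overline\mu]$ the function $\Phi_\gamma$ is a KL function of exponent $\theta\in[\frac12,1)$. Then the sequence $\{x^k\}_{k\in\mathbb N}$ converges to a point $\overline x\in S^*$, and there exist $\varrho\in(0,1)$ and $c_1>0$ such that for all sufficiently large $k$, $$\|x^k-\overline x\|\le\begin{cases}c_1\varrho^k&\text{if }\theta=1/2,\\ c_1k^{\frac{1-\theta}{1-2\theta}}&\text{if }\theta\in(\tfrac12,1).\end{cases}$$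
   Context: **Problem.** $\mathbb X$ is a finite-dimensional real vector space with inner product $\langle\cdot,\cdot\rangle$ and induced norm $\|\cdot\|$; $\overline{\mathbb R}=(-\infty,\infty]$; $\mathcal I$ is the identity on $\mathbb X$; for a linear operator, $\|\cdot\|$ is the spectral norm; $\mathcal Q\succeq\mathcal Q'$ means that $\mathcal Q-\mathcal Q'$ is self-adjoint and positive semidefinite. The functions $f,g:\mathbb X\to\overline{\mathbb R}$ are proper, $F:=f+g$, and: (i) $g$ is lower semicontinuous (lsc), convex, and continuous relative to its domain ${\rm dom}\,g$; (ii) $f$ is lsc and twice continuously differentiable on an open set $\mathcal O\supset{\rm cl}({\rm dom}\,g)$; (iii) $\inf_{x\in\mathbb X}F(x)>-\infty$. The set of stationary points is $S^*:=\{x\in\mathbb X: 0\in\nabla f(x)+\partial g(x)\}$. **The VMiPG method.** Parameters: $\underline\mu>0$, $\beta\in(0,1)$, $\sigma\in(0,\frac12\min\{1,\underline\mu\})$, a bounded sequence $\{\varepsilon_k\}\subset(0,\infty)$, and $x^0\in{\rm dom}\,g$. It is assumed that there is $\overline k\in\mathbb N$ with $\varepsilon_k\in(0,\underline\mu/10]$ for all $k\ge\overline k$. For $k=0,1,2,\dots$: 1. Select a self-adjoint linear operator $\mathcal G_k:\mathbb X\to\mathbb X$ with $\mathcal G_k\succeq\underline\mu\mathcal I$. Let $\Theta_k(x):=f(x^k)+\langle\nabla f(x^k),x-x^k\rangle+\frac12\langle x-x^k,\mathcal G_k(x-x^k)\rangle+g(x)$ and let $\overline x^k$ be its unique minimizer.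 Choose $y^k$ with $\Theta_k(y^k)<\Theta_k(x^k)$ and $\Theta_k(y^k)-\Theta_k(\overline x^k)\le\varsigma_k:=\varepsilon_k\|y^k-x^k\|^2$. 2. Put $d^k:=y^k-x^k$ and let $m_k$ be the smallest nonnegative integer $m$ with $F(x^k)-F(x^k+\beta^m d^k)\ge\sigma\beta^m\|d^k\|^2$. 3. Put $\alpha_k:=\beta^{m_k}$ and $x^{k+1}:=y^k$ if $F(y^k)<F(x^k+\alpha_kd^k)$, and $x^{k+1}:=x^k+\alpha_kd^k$ otherwise. **The potential function.** When $\{x^k\}$ and $\{\|\mathcal G_k\|\}$ are bounded, $\{y^k\}$ is bounded too, and there is a compact convex set $\Gamma$ with $\{x^k\}\cup\{y^k\}\subset\Gamma\subset\mathcal O$; fix such a $\Gamma$ and let $L_f>0$ be a Lipschitz constant of $\nabla f$ on $\Gamma$. For $\gamma>0$ the forward-backward envelope of $F$ is $$F_\gamma(x):=\inf_{y\in\mathbb X}\Big\{g(y)+\langle\nabla f(x),y-x\rangle+\tfrac1{2\gamma}\|y-x\|^2+f(x)\Big\}\ \text{ if }x\in{\rm cl}({\rm dom}\,g),\qquad F_\gamma(x):=\infty\ \text{ otherwise,}$$ and $$\Phi_\gamma(z):=F_\gamma(x)+\tfrac{L_f}{2}\|y-x\|^2+t^2,\qquad z=(x,y,t)\in\mathbb Z:=\mathbb X\times\mathbb X\times\mathbb R_+,$$ with $\|z\|=\sqrt{\|x\|^2+\|y\|^2+t^2}$ (the derivative in $t$ being $2t$). **KL functions of exponent $\theta$.**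 A proper function $h$ has the KL property of exponent $\theta\in[0,1)$ at $\overline z\in{\rm dom}\,\partial h$ ($\partial h$ the limiting subdifferential) if there are $\delta>0$, $\varpi\in(0,\infty]$, $c>0$ such that, with $\varphi(s)=cs^{1-\theta}$, $\varphi'(h(z)-h(\overline z))\,{\rm dist}(0,\partial h(z))\ge1$ for all $z$ with $\|z-\overline z\|\le\delta$ and $h(\overline z)<h(z)<h(\overline z)+\varpi$. $h$ is a KL function of exponent $\theta$ if it has the KL property of exponent $\theta$ at every point of ${\rm dom}\,\partial h$. *)

theory Defs
  imports "HOL-Analysis.Analysis"
begin

subsection \<open>Extended-real-valued functions\<close>

definition edom :: "('a \<Rightarrow> ereal) \<Rightarrow> 'a set" where
  "edom h = {x. h x < \<infinity>}"

definition proper_fun :: "('a \<Rightarrow> ereal) \<Rightarrow> bool" where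
  "proper_fun h \<longleftrightarrow> (\<forall>x. h x \<noteq> -\<infinity>) \<and> edom h \<noteq> {}"

definition lsc_fun :: "('a::topological_space \<Rightarrow> ereal) \<Rightarrow> bool" where
  "lsc_fun h \<longleftrightarrow> (\<forall>x. h x \<le> Liminf (at x) h)"

text \<open>Meant for functions that never take the value \<open>-\<infinity>\<close>, so that the right-hand side never
  contains the sum \<open>\<infinity> + -\<infinity>\<close>.\<close>

definition convex_fun :: "('a::real_vector \<Rightarrow> ereal) \<Rightarrow> bool" where
  "convex_fun h \<longleftrightarrow>
     (\<forall>x y. \<forall>s\<in>{0<..<1::real}.
        h ((1 - s) *\<^sub>R x + s *\<^sub>R y) \<le> ereal (1 - s) * h x + ereal s * h y)"

text \<open>The gradient is only meaningful at points near which \<open>f\<close> is finite; \<open>C2_on\<close> below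
  guarantees this on its (open) set.\<close>

definition grad :: "('a::euclidean_space \<Rightarrow> ereal) \<Rightarrow> 'a \<Rightarrow> 'a" where
  "grad f x = (THE D. GDERIV (\<lambda>z. real_of_ereal (f z)) x :> D)"

definition C2_on :: "'a::euclidean_space set \<Rightarrow> ('a \<Rightarrow> ereal) \<Rightarrow> bool" where
  "C2_on U f \<longleftrightarrow>
     (\<forall>x\<in>U. \<bar>f x\<bar> \<noteq> \<infinity>) \<and>
     (\<forall>x\<in>U. GDERIV (\<lambda>z. real_of_ereal (f z)) x :> grad f x) \<and>
     (\<exists>H :: 'a \<Rightarrow> 'a \<Rightarrow>\<^sub>L 'a.
        (\<forall>x\<in>U. (grad f has_derivative blinfun_apply (H x)) (at x)) \<and> continuous_on U H)"

subsection \<open>Subdifferentials, stationary points and the KL property\<close>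

definition regular_subdiff :: "('a::euclidean_space \<Rightarrow> ereal) \<Rightarrow> 'a \<Rightarrow> 'a set" where
  "regular_subdiff h x =
     {v. \<bar>h x\<bar> \<noteq> \<infinity> \<and>
         0 \<le> Liminf (at x) (\<lambda>z. (h z - h x - ereal (v \<bullet> (z - x))) / ereal (norm (z - x)))}"

definition limiting_subdiff :: "('a::euclidean_space \<Rightarrow> ereal) \<Rightarrow> 'a \<Rightarrow> 'a set" where
  "limiting_subdiff h x =
     {v. \<bar>h x\<bar> \<noteq> \<infinity> \<and>
         (\<exists>X V. X \<longlonglongrightarrow> x \<and> (\<lambda>n. h (X n)) \<longlonglongrightarrow> h x \<and>
                (\<forall>n. V n \<in> regular_subdiff h (X n)) \<and> V \<longlonglongrightarrow> v)}"

definition stationary_points ::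
    "('a::euclidean_space \<Rightarrow> ereal) \<Rightarrow> ('a \<Rightarrow> ereal) \<Rightarrow> 'a set" where
  "stationary_points f g = {x. \<exists>v\<in>limiting_subdiff g x. grad f x + v = 0}"

text \<open>The distance from the origin; it is \<open>\<infinity>\<close> for the empty set (unlike \<open>infdist\<close>, which is
  then \<open>0\<close>).\<close>

definition edist0 :: "'a::real_normed_vector set \<Rightarrow> ereal" where
  "edist0 S = (INF v\<in>S. ereal (norm v))"

text \<open>The KL property for a function regarded as a function on \<open>Z\<close>: the points \<open>z\<close> range over
  \<open>Z\<close>, while the subdifferential is that of \<open>h\<close> on the whole space. The desingularizing function
  is \<open>s \<mapsto> c s\<^sup>1\<^sup>-\<^sup>\<theta>\<close>.\<close>

definition KL_property_on ::
    "'a::euclidean_space set \<Rightarrow> ('a \<Rightarrow> ereal) \<Rightarrow> real \<Rightarrow> 'a \<Rightarrow> bool" where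
  "KL_property_on Z h \<theta> zb \<longleftrightarrow>
     (\<exists>\<delta>>0. \<exists>\<omega>::ereal. \<exists>c>0. 0 < \<omega> \<and>
        (\<forall>z\<in>Z. norm (z - zb) \<le> \<delta> \<longrightarrow> h zb < h z \<longrightarrow> h z < h zb + \<omega> \<longrightarrow>
           1 \<le> ereal (deriv (\<lambda>s. c * s powr (1 - \<theta>)) (real_of_ereal (h z - h zb)))
                * edist0 (limiting_subdiff h z)))"

definition KL_function_on ::
    "'a::euclidean_space set \<Rightarrow> ('a \<Rightarrow> ereal) \<Rightarrow> real \<Rightarrow> bool" where
  "KL_function_on Z h \<theta> \<longleftrightarrow>
     proper_fun h \<and>
     (\<forall>zb\<in>Z. limiting_subdiff h zb \<noteq> {} \<longrightarrow> KL_property_on Z h \<theta> zb)"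

subsection \<open>The line-search based variable metric inexact proximal gradient method\<close>

definition self_adjoint :: "('a::euclidean_space \<Rightarrow> 'a) \<Rightarrow> bool" where
  "self_adjoint A \<longleftrightarrow> linear A \<and> adjoint A = A"

definition loewner_ge :: "('a::euclidean_space \<Rightarrow> 'a) \<Rightarrow> ('a \<Rightarrow> 'a) \<Rightarrow> bool" where
  "loewner_ge A B \<longleftrightarrow>
     self_adjoint (\<lambda>v. A v - B v) \<and> (\<forall>v. 0 \<le> v \<bullet> (A v - B v))"

definition prox_model ::
    "('a::euclidean_space \<Rightarrow> ereal) \<Rightarrow> ('a \<Rightarrow> ereal) \<Rightarrow> ('a \<Rightarrow> 'a) \<Rightarrow> 'a \<Rightarrow> 'a \<Rightarrow> ereal" where
  "prox_model f g G xk z =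
     f xk + ereal (grad f xk \<bullet> (z - xk)) + ereal (1/2 * ((z - xk) \<bullet> G (z - xk))) + g z"

definition inexact_prox_step ::
    "('a::euclidean_space \<Rightarrow> ereal) \<Rightarrow> ('a \<Rightarrow> ereal) \<Rightarrow> real \<Rightarrow> ('a \<Rightarrow> 'a) \<Rightarrow> 'a \<Rightarrow> 'a \<Rightarrow> bool" where
  "inexact_prox_step f g \<epsilon> G xk yk \<longleftrightarrow>
     prox_model f g G xk yk < prox_model f g G xk xk \<and>
     (\<exists>xb. is_arg_min (prox_model f g G xk) (\<lambda>_. True) xb \<and>
           prox_model f g G xk yk - prox_model f g G xk xb \<le> ereal (\<epsilon> * (norm (yk - xk))\<^sup>2))"

definition sufficient_decrease ::
    "('a::euclidean_space \<Rightarrow> ereal) \<Rightarrow> real \<Rightarrow> real \<Rightarrow> 'a \<Rightarrow> 'a \<Rightarrow> nat \<Rightarrow> bool" where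
  "sufficient_decrease F \<beta> \<sigma> xk d m \<longleftrightarrow>
     F xk - F (xk + \<beta>^m *\<^sub>R d) \<ge> ereal (\<sigma> * \<beta>^m * (norm d)\<^sup>2)"

definition linesearch_update ::
    "('a::euclidean_space \<Rightarrow> ereal) \<Rightarrow> real \<Rightarrow> real \<Rightarrow> 'a \<Rightarrow> 'a \<Rightarrow> 'a \<Rightarrow> bool" where
  "linesearch_update F \<beta> \<sigma> xk yk xk' \<longleftrightarrow>
     (\<exists>m. sufficient_decrease F \<beta> \<sigma> xk (yk - xk) m \<and>
          (\<forall>j<m. \<not> sufficient_decrease F \<beta> \<sigma> xk (yk - xk) j) \<and>
          xk' = (if F yk < F (xk + \<beta>^m *\<^sub>R (yk - xk)) then yk
                 else xk + \<beta>^m *\<^sub>R (yk - xk)))"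

definition VMiPG ::
    "('a::euclidean_space \<Rightarrow> ereal) \<Rightarrow> ('a \<Rightarrow> ereal) \<Rightarrow> real \<Rightarrow> real \<Rightarrow> real \<Rightarrow> (nat \<Rightarrow> real) \<Rightarrow>
     (nat \<Rightarrow> 'a \<Rightarrow> 'a) \<Rightarrow> (nat \<Rightarrow> 'a) \<Rightarrow> (nat \<Rightarrow> 'a) \<Rightarrow> bool" where
  "VMiPG f g \<mu> \<beta> \<sigma> \<epsilon> G x y \<longleftrightarrow>
     x 0 \<in> edom g \<and>
     (\<forall>k. self_adjoint (G k) \<and> loewner_ge (G k) (\<lambda>v. \<mu> *\<^sub>R v) \<and>
          inexact_prox_step f g (\<epsilon> k) (G k) (x k) (y k) \<and>
          linesearch_update (\<lambda>z. f z + g z) \<beta> \<sigma> (x k) (y k) (x (Suc k)))"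

subsection \<open>The potential function\<close>

definition FBE ::
    "('a::euclidean_space \<Rightarrow> ereal) \<Rightarrow> ('a \<Rightarrow> ereal) \<Rightarrow> real \<Rightarrow> 'a \<Rightarrow> ereal" where
  "FBE f g \<gamma> x =
     (if x \<in> closure (edom g)
      then (INF y. g y + ereal (grad f x \<bullet> (y - x)) + ereal (1 / (2 * \<gamma>) * (norm (y - x))\<^sup>2) + f x)
      else \<infinity>)"

text \<open>The potential lives on \<open>X \<times> X \<times> [0, \<infinity>)\<close>, with derivative \<open>2 t\<close> in \<open>t\<close> also at \<open>t = 0\<close>.
  Hence it is given by its formula for all real \<open>t\<close>, and the constraint \<open>t \<ge> 0\<close> is imposed
  through the set \<open>Z\<close> of the KL property. The norm on the product type is the Euclidean one.\<close>

definition potential ::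
    "('a::euclidean_space \<Rightarrow> ereal) \<Rightarrow> ('a \<Rightarrow> ereal) \<Rightarrow> real \<Rightarrow> real \<Rightarrow> 'a \<times> 'a \<times> real \<Rightarrow> ereal" where
  "potential f g L \<gamma> = (\<lambda>(x, y, t). FBE f g \<gamma> x + ereal (L / 2 * (norm (y - x))\<^sup>2) + ereal (t\<^sup>2))"

definition potential_space :: "('a::euclidean_space \<times> 'a \<times> real) set" where
  "potential_space = UNIV \<times> UNIV \<times> {0..}"

end

theory Submission
  imports Defs
begin

text \<open>
  Write \<open>d k = y k - x k\<close> and let \<open>F\<^sub>*\<close> be the limit of the decreasing objective values \<open>F (x k)\<close>. Convergence rests
  on three estimates.

  First, descent: the model has curvature at least \<open>\<mu>\<close> and the gradient of \<open>f\<close> is Lipschitz on \<open>\<Gamma>\<close>, so the accepted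
  step sizes are bounded away from \<open>0\<close> (\<open>small_steps_accepted\<close>). Hence \<open>F (x k) - F (x (k + 1))\<close> is at least a
  multiple of \<open>\<parallel>d k\<parallel>\<^sup>2\<close>, while the iterate moves by at most \<open>\<parallel>d k\<parallel>\<close>.

  Second, at \<open>z k = (x k, y k, sqrt (\<epsilon> k) * \<parallel>d k\<parallel>)\<close> the potential \<open>\<Phi>\<close> separates consecutive values:
  \<open>F (x (k + 1)) \<le> \<Phi> (z k) \<le> F (x k) + O(\<parallel>d k\<parallel>\<^sup>2)\<close> (\<open>potential_bounds\<close>). The lower bound uses \<open>\<gamma> \<le> 1 / \<mu>'\<close>, by which
  the model defining the forward-backward envelope dominates the model of the method.

  Third, \<open>\<Phi>\<close> has a subgradient of norm \<open>O(\<parallel>d k\<parallel>)\<close> at \<open>z k\<close> (\<open>potential_subgradients\<close>). The exact minimizer of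
  the model is within \<open>O(\<parallel>d k\<parallel>)\<close> of \<open>x k\<close> by quadratic growth, so is the proximal point defining the envelope, and the
  gradient of the envelope is bounded by a multiple of the distance between \<open>x k\<close> and that point.

  All cluster points are stationary, and at each of them, paired with itself and \<open>0\<close>, \<open>\<Phi>\<close> takes the value \<open>F\<^sub>*\<close>. By compactness the
  KL property therefore holds along the tail of \<open>z k\<close> with uniform constants (\<open>value_error_bound\<close>). Combined with
  the second and third estimates it gives \<open>(F (x (k + 1)) - F\<^sub>*) powr \<theta> \<le> C * \<parallel>d k\<parallel>\<close>. The rest is a statement about
  real sequences (\<open>KL_descent_rates\<close>): the two conditions on \<open>F (x k) - F\<^sub>*\<close> and \<open>\<parallel>d k\<parallel>\<close> force
  \<open>\<parallel>x k - lim x\<parallel> = O((F (x (k - 1)) - F\<^sub>*) powr (1 - \<theta>))\<close> and a recursion that determines the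
  rate at which \<open>F (x k) - F\<^sub>*\<close> vanishes.
\<close>

section \<open>Real sequences under descent and KL conditions\<close>

text \<open>The function \<open>s \<mapsto> s powr (1 - q) / (1 - q)\<close> is concave with derivative \<open>s powr (- q)\<close>, whatever
  the sign of \<open>1 - q\<close>. The case \<open>q = \<theta> < 1\<close> is the concavity of the desingularizing function; the case
  \<open>q = 2 * \<theta> > 1\<close> turns a recursion for the values into linear growth of a negative power of them.\<close>

lemma powr_tangent_bound:
  fixes u v q :: real
  assumes v: "0 < v" "v \<le> u" and q: "0 \<le> q" "q \<noteq> 1"
  shows "(u - v) * u powr (- q) \<le> (u powr (1 - q) - v powr (1 - q)) / (1 - q)"
proof (cases "v = u")
  case False
  then have "v < u" using v by simp
  have "\<exists>\<xi>. v < \<xi> \<and> \<xi> < u \<and>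
      u powr (1 - q) / (1 - q) - v powr (1 - q) / (1 - q) = (u - v) * \<xi> powr (- q)"
  proof (rule MVT2[OF \<open>v < u\<close>])
    fix s assume "v \<le> s" "s \<le> u"
    then have "0 < s" using v by simp
    then show "((\<lambda>s. s powr (1 - q) / (1 - q)) has_real_derivative s powr (- q)) (at s)"
      using q by (auto intro!: derivative_eq_intros)
  qed
  then obtain \<xi> where \<xi>: "v < \<xi>" "\<xi> < u"
    and eq: "u powr (1 - q) / (1 - q) - v powr (1 - q) / (1 - q) = (u - v) * \<xi> powr (- q)"
    by blast
  have "u powr (- q) \<le> \<xi> powr (- q)"
    using \<xi> v q by (intro powr_mono2') auto
  then have "(u - v) * u powr (- q) \<le> (u - v) * \<xi> powr (- q)"
    using \<open>v < u\<close> by (intro mult_left_mono) auto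
  then show ?thesis using eq by (simp add: diff_divide_distrib)
qed simp

text \<open>Steps dominated by the decrements of a null sequence \<open>e\<close> have finite length, and \<open>e\<close> itself bounds
  the distance to the limit; no separate estimate of the tail sums is needed for a rate.\<close>

lemma telescoping_steps_converge:
  fixes x :: "nat \<Rightarrow> 'a::banach" and e :: "nat \<Rightarrow> real"
  assumes step: "\<And>n. n \<ge> N \<Longrightarrow> norm (x (Suc n) - x n) \<le> e n - e (Suc n)"
    and e: "e \<longlonglongrightarrow> 0"
  obtains l where "x \<longlonglongrightarrow> l" "\<And>n. n \<ge> N \<Longrightarrow> norm (x n - l) \<le> e n"
proof -
  have tail: "norm (x m - x n) \<le> e n - e m" if "N \<le> n" "n \<le> m" for m n
    using that(2)
  proof (induction m rule: dec_induct)
    case (step m)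
    then show ?case
      using assms(1)[of m] that(1) norm_triangle_ineq[of "x (Suc m) - x m" "x m - x n"] by simp
  qed simp
  have "Cauchy x"
  proof (rule metric_CauchyI)
    fix \<epsilon> :: real assume "0 < \<epsilon>"
    then obtain M where M: "\<And>n. n \<ge> M \<Longrightarrow> \<bar>e n\<bar> < \<epsilon> / 2"
      using LIMSEQ_D[OF e, of "\<epsilon> / 2"] by auto
    have close: "dist (x m) (x n) < \<epsilon>" if "max M N \<le> n" "n \<le> m" for m n
      using tail[of n m] M[of n] M[of m] that by (simp add: dist_norm)
    then show "\<exists>M. \<forall>m\<ge>M. \<forall>n\<ge>M. dist (x m) (x n) < \<epsilon>"
      by (metis dist_commute nle_le)
  qed
  then obtain l where l: "x \<longlonglongrightarrow> l"
    using Cauchy_convergent convergent_def by blast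
  have "norm (x n - l) \<le> e n" if "n \<ge> N" for n
  proof (rule tendsto_le)
    show "(\<lambda>m. norm (x n - x m)) \<longlonglongrightarrow> norm (x n - l)"
      by (intro tendsto_intros l)
    show "(\<lambda>m. e n - e m) \<longlonglongrightarrow> e n"
      using tendsto_diff[OF tendsto_const e, of "e n"] by simp
    show "\<forall>\<^sub>F m in sequentially. norm (x n - x m) \<le> e n - e m"
      using eventually_ge_at_top[of n]
      by eventually_elim (use tail[OF that] in \<open>simp add: norm_minus_commute\<close>)
  qed simp
  with l that show thesis by blast
qed

lemma geometric_decay:
  fixes r :: "nat \<Rightarrow> real"
  assumes b: "b > 0" and rec: "\<And>n. b * r (Suc n) \<le> r n - r (Suc n)"
  shows "r n \<le> r 0 * (1 / (1 + b)) ^ n"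
proof (induction n)
  case (Suc n)
  have "r (Suc n) \<le> r n * (1 / (1 + b))"
    using rec[of n] b by (simp add: field_simps)
  also have "\<dots> \<le> r 0 * (1 / (1 + b)) ^ n * (1 / (1 + b))"
    using Suc b by (intro mult_right_mono) auto
  finally show ?case by (simp add: mult_ac)
qed simp

text \<open>The recursion discretizes \<open>r' = - b * r powr p\<close>, along which \<open>r powr (1 - p)\<close> grows linearly. To see
  that every discrete step also increases \<open>r powr (1 - p)\<close> by a fixed amount, distinguish whether the
  step keeps at least half of the value (the tangent bound applies, because \<open>r (Suc n)\<close> and \<open>r n\<close> are
  comparable) or not (falling below half the value multiplies the power by at least \<open>2 powr (p - 1)\<close>).\<close>

lemma polynomial_decay:
  fixes r :: "nat \<Rightarrow> real"
  assumes b: "b > 0" and p: "p > 1" and pos: "\<And>n. r n > 0"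
    and rec: "\<And>n. b * r (Suc n) powr p \<le> r n - r (Suc n)"
  obtains \<eta> where "\<eta> > 0" "\<And>n. n > 0 \<Longrightarrow> r n \<le> (\<eta> * real n) powr (- 1 / (p - 1))"
proof -
  define \<eta> where "\<eta> = min ((p - 1) * b * (1/2) powr p) ((2 powr (p - 1) - 1) * r 0 powr (1 - p))"
  have "2 powr (p - 1) > (1::real)" using p by simp
  then have \<eta>: "\<eta> > 0" unfolding \<eta>_def using b p pos[of 0] by simp
  have dec: "r (Suc n) \<le> r n" for n
    using rec[of n] b by (smt (verit) mult_nonneg_nonneg powr_ge_zero)
  have le0: "r n \<le> r 0" for n
    by (induction n) (use dec order_trans in auto)
  have inc: "\<eta> \<le> r (Suc n) powr (1 - p) - r n powr (1 - p)" for n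
  proof (cases "r (Suc n) \<ge> r n / 2")
    case True
    have "(1/2) powr p \<le> (r (Suc n) / r n) powr p"
      using True p pos[of n] by (intro powr_mono2) (auto simp: field_simps)
    then have "(1/2) powr p \<le> r (Suc n) powr p * r n powr (- p)"
      using pos[of n] pos[of "Suc n"] by (simp add: powr_divide powr_minus_divide)
    then have "b * (1/2) powr p \<le> b * (r (Suc n) powr p * r n powr (- p))"
      using b by (intro mult_left_mono) auto
    also have "\<dots> \<le> (r n - r (Suc n)) * r n powr (- p)"
      using mult_right_mono[OF rec[of n], of "r n powr (- p)"] by (simp add: mult_ac)
    also have "\<dots> \<le> (r n powr (1 - p) - r (Suc n) powr (1 - p)) / (1 - p)"
      using powr_tangent_bound[of "r (Suc n)" "r n" p] dec[of n] pos[of "Suc n"] p by simp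
    finally have "(p - 1) * (b * (1/2) powr p) \<le> r (Suc n) powr (1 - p) - r n powr (1 - p)"
      using p by (simp add: field_simps)
    then show ?thesis unfolding \<eta>_def by (simp add: mult_ac)
  next
    case False
    have "r 0 powr (1 - p) \<le> r n powr (1 - p)"
      using le0[of n] pos[of n] p by (intro powr_mono2') auto
    then have "(2 powr (p - 1) - 1) * r 0 powr (1 - p) \<le> (2 powr (p - 1) - 1) * r n powr (1 - p)"
      using \<open>2 powr (p - 1) > 1\<close> by (intro mult_left_mono) auto
    also have "\<dots> = (r n / 2) powr (1 - p) - r n powr (1 - p)"
      using pos[of n] by (simp add: powr_divide powr_diff field_simps)
    also have "(r n / 2) powr (1 - p) \<le> r (Suc n) powr (1 - p)"
      using False pos[of "Suc n"] p by (intro powr_mono2') auto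
    finally show ?thesis unfolding \<eta>_def by simp
  qed
  have lin: "\<eta> * real n \<le> r n powr (1 - p)" for n
  proof (induction n)
    case (Suc n)
    then show ?case using inc[of n] by (simp add: algebra_simps)
  qed simp
  have "r n \<le> (\<eta> * real n) powr (- 1 / (p - 1))" if "n > 0" for n
  proof -
    have "(r n powr (1 - p)) powr (- 1 / (p - 1)) \<le> (\<eta> * real n) powr (- 1 / (p - 1))"
      using lin[of n] \<eta> p that by (intro powr_mono2') auto
    moreover have "(r n powr (1 - p)) powr (- 1 / (p - 1)) = r n"
    proof -
      have "(1 - p) * (- 1 / (p - 1)) = 1" using p by (simp add: field_simps)
      then show ?thesis using pos[of n] by (simp only: powr_powr) simp
    qed
    ultimately show ?thesis by simp
  qed
  with \<eta> that show thesis by blast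
qed

text \<open>The part of the argument that concerns real sequences only. Here \<open>r\<close> stands for the gap to the limiting
  value, and the error condition bounds a power of the \<^emph>\<open>next\<close> gap by the current step. Put
  \<open>\<phi> n = r n powr (1 - \<theta>)\<close>. Concavity of \<open>s powr (1 - \<theta>)\<close>, the descent and the error condition give
  \<open>(D n)\<^sup>2 \<le> D (n - 1) * B * (\<phi> n - \<phi> (Suc n))\<close>, and the inequality of the means turns this into
  \<open>D n \<le> e n - e (Suc n)\<close> with \<open>e n = D (n - 1) + B * \<phi> n\<close>. So \<open>x\<close> converges and the distance to its
  limit is at most \<open>e n\<close>, which is of order \<open>r (n - 1) powr (1 - \<theta>)\<close> since \<open>D\<close> is of order \<open>sqrt r\<close> and
  \<open>1 - \<theta> \<le> 1/2\<close>. The rate of \<open>r\<close> comes from combining descent and error condition into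
  \<open>r n - r (Suc n) \<ge> b * r (Suc n) powr (2 * \<theta>)\<close>: geometric decay for \<open>\<theta> = 1/2\<close>, polynomial decay
  otherwise.\<close>

lemma KL_descent_rates:
  fixes x :: "nat \<Rightarrow> 'a::banach" and r D :: "nat \<Rightarrow> real"
  assumes pos: "a > 0" "C > 0" and \<theta>: "1 / 2 \<le> \<theta>" "\<theta> < 1"
    and r: "\<And>n. r n > 0" "r \<longlonglongrightarrow> 0" and D: "\<And>n. D n \<ge> 0"
    and descent: "\<And>n. a * (D n)\<^sup>2 \<le> r n - r (Suc n)"
    and error: "\<And>n. n \<ge> N \<Longrightarrow> r (Suc n) powr \<theta> \<le> C * D n"
    and step: "\<And>n. norm (x (Suc n) - x n) \<le> D n"
  obtains l \<rho> c where "x \<longlonglongrightarrow> l" "\<rho> \<in> {0<..<1}" "c > 0"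
    "\<forall>\<^sub>F n in sequentially. (\<theta> = 1/2 \<longrightarrow> norm (x n - l) \<le> c * \<rho> ^ n) \<and>
       (\<theta> \<in> {1/2<..<1} \<longrightarrow> norm (x n - l) \<le> c * real n powr ((1 - \<theta>) / (1 - 2 * \<theta>)))"
proof -
  define B where "B = C / (a * (1 - \<theta>))"
  have B: "B > 0" unfolding B_def using pos \<theta> by simp
  define \<phi> where "\<phi> n = r n powr (1 - \<theta>)" for n
  define e where "e n = D (n - 1) + B * \<phi> n" for n
  have dec: "r (Suc n) \<le> r n" for n
    using descent[of n] pos(1) by (smt (verit) mult_nonneg_nonneg zero_le_power2)
  have D_le: "D n \<le> (1 / sqrt a) * r n powr (1/2)" for n
  proof -
    have "(D n)\<^sup>2 \<le> r n / a"
      using descent[of n] r(1)[of "Suc n"] pos(1) by (simp add: field_simps)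
    then have "D n \<le> sqrt (r n / a)" by (simp add: real_le_rsqrt)
    then show ?thesis using r(1)[of n] by (simp add: powr_half_sqrt real_sqrt_divide)
  qed
  have \<phi>0: "\<phi> \<longlonglongrightarrow> 0"
    unfolding \<phi>_def using tendsto_powr'[OF r(2) tendsto_const, of "1 - \<theta>"] \<theta> r(1)
    by (auto simp: less_imp_le)
  have D0: "D \<longlonglongrightarrow> 0"
  proof (rule tendsto_sandwich[OF _ _ tendsto_const])
    show "(\<lambda>n. (1 / sqrt a) * r n powr (1/2)) \<longlonglongrightarrow> 0"
      using tendsto_mult[OF tendsto_const tendsto_powr'[OF r(2) tendsto_const, of "1/2"], of "1 / sqrt a"] r(1)
      by (auto simp: less_imp_le)
  qed (use D D_le in auto)
  have "(\<lambda>n. e (Suc n)) \<longlonglongrightarrow> 0"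
    unfolding e_def using tendsto_add[OF D0 tendsto_mult_right_zero[OF LIMSEQ_Suc[OF \<phi>0], of B]] by simp
  then have e0: "e \<longlonglongrightarrow> 0" by (rule LIMSEQ_imp_Suc)
  have tele: "norm (x (Suc n) - x n) \<le> e n - e (Suc n)" if n: "n \<ge> Suc N" for n
  proof -
    obtain k where k: "n = Suc k" "k \<ge> N" using n Suc_le_D[of N n] by auto
    have \<phi>_dec: "\<phi> n - \<phi> (Suc n) \<ge> 0"
      unfolding \<phi>_def using dec[of n] r(1)[of "Suc n"] \<theta> by (simp add: powr_mono2)
    have "(1 - \<theta>) * (r n - r (Suc n)) * r n powr (- \<theta>) \<le> \<phi> n - \<phi> (Suc n)"
      using powr_tangent_bound[of "r (Suc n)" "r n" \<theta>] dec[of n] r(1)[of "Suc n"] \<theta>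
      unfolding \<phi>_def by (simp add: field_simps)
    then have "(1 - \<theta>) * (r n - r (Suc n)) \<le> (\<phi> n - \<phi> (Suc n)) * r n powr \<theta>"
      using r(1)[of n] by (simp add: powr_minus field_simps)
    also have "\<dots> \<le> (\<phi> n - \<phi> (Suc n)) * (C * D k)"
      using error[of k] k \<phi>_dec by (intro mult_left_mono) auto
    finally have "(1 - \<theta>) * (r n - r (Suc n)) \<le> (\<phi> n - \<phi> (Suc n)) * (C * D k)" .
    moreover have "(1 - \<theta>) * (a * (D n)\<^sup>2) \<le> (1 - \<theta>) * (r n - r (Suc n))"
      using descent[of n] \<theta> by (intro mult_left_mono) auto
    ultimately have "(D n)\<^sup>2 \<le> D k * (B * (\<phi> n - \<phi> (Suc n)))"
      unfolding B_def using pos \<theta> by (simp add: field_simps)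
    moreover have "0 \<le> (D k - B * (\<phi> n - \<phi> (Suc n)))\<^sup>2" by simp
    \<comment> \<open>The inequality of the arithmetic and geometric means, in squared form.\<close>
    ultimately have "(2 * D n)\<^sup>2 \<le> (D k + B * (\<phi> n - \<phi> (Suc n)))\<^sup>2"
      by (simp add: power2_eq_square algebra_simps)
    then have "2 * D n \<le> D k + B * (\<phi> n - \<phi> (Suc n))"
      by (rule power2_le_imp_le) (use D[of k] B \<phi>_dec in simp)
    then show ?thesis
      using step[of n] unfolding e_def k(1) by (simp add: algebra_simps)
  qed
  obtain l where l: "x \<longlonglongrightarrow> l" "\<And>n. n \<ge> Suc N \<Longrightarrow> norm (x n - l) \<le> e n"
    using telescoping_steps_converge[where x=x and e=e and N="Suc N"] tele e0 by blast
  obtain N1 where N1: "\<And>n. n \<ge> N1 \<Longrightarrow> r n \<le> 1"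
    using LIMSEQ_D[OF r(2), of 1] by (force simp: less_imp_le)
  define M where "M = max N N1"
  define K where "K = 1 / sqrt a + B"
  have K: "K > 0" unfolding K_def using B pos by (simp add: add_pos_pos)
  have dist_le: "norm (x (Suc n) - l) \<le> K * r n powr (1 - \<theta>)" if "n \<ge> M" for n
  proof -
    have "norm (x (Suc n) - l) \<le> D n + B * \<phi> (Suc n)"
      using l(2)[of "Suc n"] that unfolding M_def e_def by simp
    moreover have "r n powr (1/2) \<le> r n powr (1 - \<theta>)"
      using N1[of n] that r(1)[of n] \<theta> unfolding M_def by (intro powr_mono') auto
    then have "(1 / sqrt a) * r n powr (1/2) \<le> (1 / sqrt a) * r n powr (1 - \<theta>)"
      using pos by (intro mult_left_mono) auto
    moreover have "B * \<phi> (Suc n) \<le> B * r n powr (1 - \<theta>)"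
      unfolding \<phi>_def using dec[of n] r(1)[of "Suc n"] \<theta> B
      by (intro mult_left_mono powr_mono2) auto
    ultimately show ?thesis using D_le[of n] unfolding K_def by (simp add: algebra_simps)
  qed
  define b where "b = a / C\<^sup>2"
  have b: "b > 0" unfolding b_def using pos by simp
  \<comment> \<open>Squaring the error condition and inserting the descent eliminates \<open>D\<close>.\<close>
  have rec: "b * r (Suc n) powr (2 * \<theta>) \<le> r n - r (Suc n)" if "n \<ge> M" for n
  proof -
    have "(r (Suc n) powr \<theta>)\<^sup>2 \<le> (C * D n)\<^sup>2"
      using error[of n] that unfolding M_def by (intro power_mono) auto
    then have "r (Suc n) powr (2 * \<theta>) \<le> C\<^sup>2 * (D n)\<^sup>2"
      by (simp add: power2_eq_square powr_add[symmetric] algebra_simps)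
    then have "b * r (Suc n) powr (2 * \<theta>) \<le> b * (C\<^sup>2 * (D n)\<^sup>2)"
      using b by (intro mult_left_mono) auto
    also have "\<dots> = a * (D n)\<^sup>2" unfolding b_def using pos by simp
    finally show ?thesis using descent[of n] by simp
  qed
  define s where "s n = r (n + M)" for n
  show thesis
  proof (cases "\<theta> = 1/2")
    case True
    define \<rho> where "\<rho> = sqrt (1 / (1 + b))"
    have \<rho>: "\<rho> \<in> {0<..<1}" unfolding \<rho>_def using b by (simp add: real_sqrt_lt_1_iff)
    have decay: "s n \<le> s 0 * (1 / (1 + b)) ^ n" for n
      proof (rule geometric_decay[OF b])
      show "b * s (Suc m) \<le> s m - s (Suc m)" for m
        using rec[of "m + M"] True less_imp_le[OF r(1)] unfolding s_def by simp
    qed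
    define c where "c = K * sqrt (s 0) / \<rho> ^ Suc M"
    have c: "c > 0" unfolding c_def s_def using K r(1) \<rho> by simp
    have bound: "norm (x n - l) \<le> c * \<rho> ^ n" if n: "n \<ge> Suc M" for n
    proof -
      obtain j where j: "n = Suc (j + M)"
        using le_Suc_ex[OF n] by (auto simp: ac_simps)
      have "norm (x n - l) \<le> K * sqrt (s j)"
        using dist_le[of "j + M"] True r(1)[of "j + M"] unfolding j s_def
        by (simp add: powr_half_sqrt)
      also have "\<dots> \<le> K * (sqrt (s 0) * \<rho> ^ j)"
        using decay[of j] K unfolding \<rho>_def
        by (intro mult_left_mono) (auto simp: real_sqrt_mult[symmetric] real_sqrt_power[symmetric])
      also have "\<dots> = c * \<rho> ^ n"
        unfolding c_def j using \<rho> by (simp add: power_add field_simps)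
      finally show ?thesis .
    qed
    show thesis
      by (rule that[OF l(1) \<rho> c])
        (use bound True in \<open>auto simp: eventually_sequentially intro!: exI[of _ "Suc M"]\<close>)
  next
    case False
    with \<theta> have \<theta>': "\<theta> > 1/2" by simp
    define E where "E = (1 - \<theta>) / (1 - 2 * \<theta>)"
    have E: "E < 0" unfolding E_def using \<theta> \<theta>' by (simp add: divide_pos_neg)
    obtain \<eta> where \<eta>: "\<eta> > 0" and decay: "\<And>n. n > 0 \<Longrightarrow> s n \<le> (\<eta> * real n) powr (- 1 / (2 * \<theta> - 1))"
      using polynomial_decay[of b "2 * \<theta>" s] b \<theta>' r(1) rec unfolding s_def by auto
    define c where "c = K * (\<eta> / 2) powr E"
    have c: "c > 0" unfolding c_def using K \<eta> by simp
    have bound: "norm (x n - l) \<le> c * real n powr E" if n: "n \<ge> 2 * M + 2" for n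
    proof -
      obtain j where j: "n = Suc (j + M)"
        using le_Suc_ex[OF n] that[of "n - M - 1"] by auto
      have j2: "j > 0" "2 * j \<ge> n" using n j by auto
      have "norm (x n - l) \<le> K * s j powr (1 - \<theta>)"
        using dist_le[of "j + M"] unfolding j s_def by simp
      also have "s j powr (1 - \<theta>) \<le> ((\<eta> * real j) powr (- 1 / (2 * \<theta> - 1))) powr (1 - \<theta>)"
        using decay[OF j2(1)] \<theta> r(1)[of "j + M"] unfolding s_def by (intro powr_mono2) auto
      also have "\<dots> = (\<eta> * real j) powr E"
      proof -
        define q where "q = 2 * \<theta> - 1"
        have "1 - 2 * \<theta> = - q" by (simp add: q_def)
        then show ?thesis unfolding powr_powr E_def q_def[symmetric] by simp
      qed
      also have "\<dots> \<le> (\<eta> / 2 * real n) powr E"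
        using j2 \<eta> E n by (intro powr_mono2') auto
      also have "\<dots> = (\<eta> / 2) powr E * real n powr E"
        by (rule powr_mult)
      finally show ?thesis unfolding c_def using K by (simp add: mult_ac)
    qed
    \<comment> \<open>The ratio is irrelevant for exponents above \<open>1/2\<close>; any value in the interval serves.\<close>
    have "(1/2::real) \<in> {0<..<1}" by simp
    then show thesis
      by (rule that[OF l(1) _ c])
        (use bound False in \<open>auto simp: E_def eventually_sequentially intro!: exI[of _ "2 * M + 2"]\<close>)
  qed
qed

section \<open>Proximal models and the forward-backward envelope\<close>

lemma edom_ereal:
  assumes "proper_fun g" "z \<in> edom g"
  shows "g z = ereal (real_of_ereal (g z))"
  using assms by (auto simp: proper_fun_def edom_def ereal_real)

lemma convex_fun_real:
  assumes g: "proper_fun g" "convex_fun g" and ab: "a \<in> edom g" "b \<in> edom g"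
    and s: "0 < s" "s < 1"
  shows "(1 - s) *\<^sub>R a + s *\<^sub>R b \<in> edom g"
    and "real_of_ereal (g ((1 - s) *\<^sub>R a + s *\<^sub>R b)) \<le> (1 - s) * real_of_ereal (g a) + s * real_of_ereal (g b)"
proof -
  let ?c = "(1 - s) *\<^sub>R a + s *\<^sub>R b"
  have "g ?c \<le> ereal (1 - s) * g a + ereal s * g b"
    using g(2) s by (auto simp: convex_fun_def)
  also have "\<dots> = ereal ((1 - s) * real_of_ereal (g a) + s * real_of_ereal (g b))"
    using edom_ereal[OF g(1) ab(1)] edom_ereal[OF g(1) ab(2)]
    by (metis plus_ereal.simps(1) times_ereal.simps(1))
  finally have le: "g ?c \<le> ereal ((1 - s) * real_of_ereal (g a) + s * real_of_ereal (g b))" .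
  then show c: "?c \<in> edom g"
    unfolding edom_def by (metis (mono_tags) mem_Collect_eq ereal_less_PInfty order.strict_trans1 less_ereal.simps(4))
  show "real_of_ereal (g ?c) \<le> (1 - s) * real_of_ereal (g a) + s * real_of_ereal (g b)"
    using le edom_ereal[OF g(1) c] by (metis ereal_less_eq(3))
qed

lemma convex_edom:
  assumes "proper_fun g" "convex_fun g"
  shows "convex (edom g)"
proof (rule convexI)
  fix a b u v assume ab: "a \<in> edom g" "b \<in> edom g" and uv: "0 \<le> u" "0 \<le> v" "u + v = (1::real)"
  then have u: "u = 1 - v" by simp
  consider "v = 0" | "v = 1" | "0 < v" "v < 1" using uv by linarith
  then show "u *\<^sub>R a + v *\<^sub>R b \<in> edom g"
    by cases (use ab convex_fun_real(1)[OF assms ab] in \<open>simp_all add: u\<close>)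
qed

text \<open>Lower semicontinuity in the form in which it is applied: upper bounds along a convergent sequence pass to
  the limit. The bounds are real, so the limit lies in the effective domain.\<close>

lemma lsc_fun_sequence_bound:
  fixes h :: "'a::metric_space \<Rightarrow> ereal"
  assumes "lsc_fun h" and X: "X \<longlonglongrightarrow> l" and b: "b \<longlonglongrightarrow> B"
    and le: "\<And>n. h (X n) \<le> ereal (b n)"
  shows "h l \<le> ereal B"
proof (rule ccontr)
  assume "\<not> h l \<le> ereal B"
  then obtain c where c: "ereal B < c" "c < h l" by (meson ereal_dense2 not_le dense)
  have "c < Liminf (at l) h"
    using assms(1) c(2) unfolding lsc_fun_def by (meson order.strict_trans2)
  then have "\<forall>\<^sub>F z in at l. c < h z" by (rule less_LiminfD)
  then have "\<forall>\<^sub>F z in nhds l. c < h z"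
    unfolding eventually_at_filter by eventually_elim (use c in auto)
  then have "\<forall>\<^sub>F n in sequentially. c < h (X n)"
    using X by (rule eventually_compose_filterlim)
  moreover have "\<forall>\<^sub>F n in sequentially. ereal (b n) < c"
    using order_tendstoD(2)[OF tendsto_ereal[OF b] c(1)] .
  ultimately have "\<forall>\<^sub>F n in sequentially. False"
    by eventually_elim (use le in \<open>meson leD order.strict_trans\<close>)
  then show False by simp
qed

text \<open>Removes the quotient from the definition of the regular subdifferential: it is enough to have the
  first-order lower expansion with an error \<open>e * norm (z - x)\<close> for every \<open>e > 0\<close>.\<close>

lemma regular_subdiffI:
  assumes fin: "\<bar>h x\<bar> \<noteq> \<infinity>"
    and lower: "\<And>e. e > 0 \<Longrightarrow> \<forall>\<^sub>F z in at x. h x + ereal (v \<bullet> (z - x) - e * norm (z - x)) \<le> h z"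
  shows "v \<in> regular_subdiff h x"
proof -
  obtain r where r: "h x = ereal r" using fin by auto
  have "\<forall>\<^sub>F z in at x. C < (h z - h x - ereal (v \<bullet> (z - x))) / ereal (norm (z - x))"
    if C: "C < 0" for C
  proof -
    obtain b where "C < ereal b" "ereal b < 0" using ereal_dense2[OF C] by blast
    then obtain e where e: "C < ereal (- e)" "e > 0" by (metis ereal_less(1) minus_minus neg_0_less_iff_less)
    have "\<forall>\<^sub>F z in at x. z \<noteq> x" by (auto simp: eventually_at_filter)
    with lower[OF e(2)] show ?thesis
    proof eventually_elim
      case (elim z)
      have "ereal (- e) \<le> (h z - h x - ereal (v \<bullet> (z - x))) / ereal (norm (z - x))"
        using elim by (cases "h z") (auto simp: r field_simps)
      with e(1) show ?case by (rule order.strict_trans2)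
    qed
  qed
  then show ?thesis using fin by (auto simp: regular_subdiff_def le_Liminf_iff)
qed

lemma regular_subdiff_imp_limiting:
  assumes "v \<in> regular_subdiff h x"
  shows "v \<in> limiting_subdiff h x"
proof -
  have "\<bar>h x\<bar> \<noteq> \<infinity>" using assms by (simp add: regular_subdiff_def)
  then show ?thesis unfolding limiting_subdiff_def
    by (intro CollectI conjI, assumption)
      (rule exI[of _ "\<lambda>_. x"], rule exI[of _ "\<lambda>_. v"], use assms in simp)
qed

lemma subgradient_in_limiting_subdiff:
  assumes g: "proper_fun g" and x: "x \<in> edom g"
    and sub: "\<And>z. z \<in> edom g \<Longrightarrow> real_of_ereal (g x) + v \<bullet> (z - x) \<le> real_of_ereal (g z)"
  shows "v \<in> limiting_subdiff g x"
proof (intro regular_subdiff_imp_limiting regular_subdiffI always_eventually allI)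
  show "\<bar>g x\<bar> \<noteq> \<infinity>" using g x by (auto simp: proper_fun_def edom_def)
  fix e :: real and z assume e: "e > 0"
  show "g x + ereal (v \<bullet> (z - x) - e * norm (z - x)) \<le> g z"
  proof (cases "z \<in> edom g")
    case True
    have "real_of_ereal (g x) + (v \<bullet> (z - x) - e * norm (z - x)) \<le> real_of_ereal (g z)"
      using sub[OF True] e by (smt (verit) mult_nonneg_nonneg norm_ge_zero)
    moreover obtain r r' where "g x = ereal r" "g z = ereal r'"
      using edom_ereal[OF g x] edom_ereal[OF g True] by blast
    ultimately show ?thesis by simp
  next
    case False
    then show ?thesis by (simp add: edom_def)
  qed
qed

text \<open>The real-valued counterpart of \<open>prox_model\<close>, which it represents on the effective domain of \<open>g\<close>. The
  proximal model with parameter \<open>\<gamma>\<close>, whose infimum is the forward-backward envelope, is the case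
  \<open>G v = (1 / \<gamma>) *\<^sub>R v\<close>.\<close>

definition real_model ::
    "('a::euclidean_space \<Rightarrow> ereal) \<Rightarrow> ('a \<Rightarrow> ereal) \<Rightarrow> ('a \<Rightarrow> 'a) \<Rightarrow> 'a \<Rightarrow> 'a \<Rightarrow> real" where
  "real_model f g G x z = real_of_ereal (f x) + grad f x \<bullet> (z - x)
     + 1/2 * ((z - x) \<bullet> G (z - x)) + real_of_ereal (g z)"

definition model_minimizer ::
    "('a::euclidean_space \<Rightarrow> ereal) \<Rightarrow> ('a \<Rightarrow> ereal) \<Rightarrow> ('a \<Rightarrow> 'a) \<Rightarrow> 'a \<Rightarrow> 'a \<Rightarrow> bool" where
  "model_minimizer f g G x p \<longleftrightarrow>
     p \<in> edom g \<and> (\<forall>z\<in>edom g. real_model f g G x p \<le> real_model f g G x z)"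

lemma prox_model_real:
  assumes "\<bar>f x\<bar> \<noteq> \<infinity>" "proper_fun g" "z \<in> edom g"
  shows "prox_model f g G x z = ereal (real_model f g G x z)"
proof -
  obtain r s where "f x = ereal r" "g z = ereal s"
    using assms(1) edom_ereal[OF assms(2,3)] by auto
  then show ?thesis by (simp add: prox_model_def real_model_def)
qed

lemma prox_model_outside:
  assumes "\<bar>f x\<bar> \<noteq> \<infinity>" "z \<notin> edom g"
  shows "prox_model f g G x z = \<infinity>"
  using assms by (auto simp: prox_model_def edom_def)

lemma arg_min_model_minimizer:
  assumes min: "is_arg_min (prox_model f g G x) (\<lambda>_. True) p"
    and fin: "\<bar>f x\<bar> \<noteq> \<infinity>" and g: "proper_fun g"
  shows "model_minimizer f g G x p"
proof -
  have le: "prox_model f g G x p \<le> prox_model f g G x z" for z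
    using min by (simp add: is_arg_min_linorder)
  obtain a where a: "a \<in> edom g" using g by (auto simp: proper_fun_def)
  have p: "p \<in> edom g"
  proof (rule ccontr)
    assume "p \<notin> edom g"
    then show False
      using le[of a] prox_model_outside[where f=f and g=g and x=x, OF fin]
        prox_model_real[where f=f and G=G, OF fin g a]
      by (metis ereal_infty_less_eq(1) PInfty_neq_ereal(1))
  qed
  show ?thesis unfolding model_minimizer_def
    using p le prox_model_real[where f=f and G=G, OF fin g] by (metis ereal_less_eq(3))
qed

text \<open>Quadratic growth at a minimizer \<open>p\<close>, in the seminorm of \<open>G\<close>: compare \<open>p\<close> with \<open>(1 - s) * p + s * z\<close>, where
  convexity of \<open>g\<close> and the exact quadratic identity leave a gain of \<open>s * (1 - s) / 2\<close> times the quadratic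
  form; divide by \<open>s\<close> and let \<open>s\<close> tend to \<open>0\<close>.\<close>

lemma model_growth:
  assumes g: "proper_fun g" "convex_fun g" and G: "linear G"
    and p: "model_minimizer f g G x p" and z: "z \<in> edom g"
  shows "real_model f g G x p + 1/2 * ((z - p) \<bullet> G (z - p)) \<le> real_model f g G x z"
proof -
  have pd: "p \<in> edom g" using p by (simp add: model_minimizer_def)
  let ?Q = "(z - p) \<bullet> G (z - p)"
  have "real_model f g G x p + (1 - s) / 2 * ?Q \<le> real_model f g G x z" if s: "0 < s" "s < 1" for s
  proof -
    define c where "c = (1 - s) *\<^sub>R p + s *\<^sub>R z"
    have c: "c \<in> edom g" unfolding c_def by (rule convex_fun_real(1)[OF g pd z s])
    have cx: "c - x = (p - x) + s *\<^sub>R (z - p)" "z - x = (p - x) + (z - p)"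
      unfolding c_def by (simp_all add: algebra_simps)
    have quad: "(c - x) \<bullet> G (c - x)
        = (1 - s) * ((p - x) \<bullet> G (p - x)) + s * ((z - x) \<bullet> G (z - x)) - s * (1 - s) * ?Q"
      unfolding cx linear_add[OF G] linear_cmul[OF G] by (simp add: inner_simps algebra_simps)
    have lin: "grad f x \<bullet> (c - x) = (1 - s) * (grad f x \<bullet> (p - x)) + s * (grad f x \<bullet> (z - x))"
      unfolding c_def by (simp add: inner_simps algebra_simps)
    have "real_model f g G x p \<le> real_model f g G x c"
      using p c by (simp add: model_minimizer_def)
    also have "\<dots> \<le> (1 - s) * real_model f g G x p + s * real_model f g G x z - s * (1 - s) / 2 * ?Q"
      using convex_fun_real(2)[OF g pd z s, folded c_def]
      unfolding real_model_def quad lin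
      by (simp add: ring_distribs add_divide_distrib diff_divide_distrib)
    finally have "s * (real_model f g G x p + (1 - s) / 2 * ?Q) \<le> s * real_model f g G x z"
      by (simp add: algebra_simps)
    then show ?thesis using s by simp
  qed
  then have "\<forall>\<^sub>F s in at_right 0. real_model f g G x p + (1 - s) / 2 * ?Q \<le> real_model f g G x z"
    unfolding eventually_at_right[OF zero_less_one] by (auto intro!: exI[of _ 1])
  moreover have "((\<lambda>s. real_model f g G x p + (1 - s) / 2 * ?Q) \<longlongrightarrow>
      real_model f g G x p + (1 - 0) / 2 * ?Q) (at_right 0)"
    by (intro tendsto_intros) auto
  ultimately have "real_model f g G x p + (1 - 0) / 2 * ?Q \<le> real_model f g G x z"
    by (intro tendsto_upperbound[where F="at_right (0::real)"]) auto
  then show ?thesis by simp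
qed

lemma self_adjoint_inner:
  assumes "self_adjoint G"
  shows "v \<bullet> G w = G v \<bullet> w"
  using assms adjoint_works[of G v w] by (simp add: self_adjoint_def)

text \<open>The optimality condition \<open>0 \<in> \<nabla>f x + G (p - x) + \<partial>g p\<close>. It is the growth inequality rewritten: by
  self-adjointness the quadratic terms combine to the linear term exactly.\<close>

lemma model_minimizer_subgradient:
  assumes g: "proper_fun g" "convex_fun g" and G: "self_adjoint G"
    and p: "model_minimizer f g G x p" and z: "z \<in> edom g"
  shows "real_of_ereal (g p) - (grad f x + G (p - x)) \<bullet> (z - p) \<le> real_of_ereal (g z)"
proof -
  have lin: "linear G" using G by (simp add: self_adjoint_def)
  define u v where "u = z - p" and "v = p - x"
  have "z - x = v + u" by (simp add: u_def v_def)
  then have "(z - x) \<bullet> G (z - x) = v \<bullet> G v + 2 * (G v \<bullet> u) + u \<bullet> G u"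
    using self_adjoint_inner[OF G, of v u] inner_commute[of u "G v"]
    by (simp only: linear_add[OF lin] inner_add_left inner_add_right)
  then have "(z - x) \<bullet> G (z - x)
      = (p - x) \<bullet> G (p - x) + 2 * (G (p - x) \<bullet> (z - p)) + (z - p) \<bullet> G (z - p)"
    by (simp add: u_def v_def)
  moreover have "grad f x \<bullet> (z - x) = grad f x \<bullet> (p - x) + grad f x \<bullet> (z - p)"
    by (simp add: inner_diff_right)
  ultimately show ?thesis
    using model_growth[OF g lin p z] unfolding real_model_def inner_add_left by linarith
qed

text \<open>The minorant makes the model coercive, so a minimizing sequence is bounded and lower
  semicontinuity applies to a convergent subsequence. In the application the minorant comes from the optimality
  condition of the minimizer that the method supplies for its own metric.\<close>

lemma prox_minimizer_exists:
  assumes g: "proper_fun g" "lsc_fun g" and \<gamma>: "\<gamma> > 0"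
    and minorant: "\<And>z. z \<in> edom g \<Longrightarrow> c + w \<bullet> z \<le> real_of_ereal (g z)"
  obtains p where "model_minimizer f g (\<lambda>v. (1 / \<gamma>) *\<^sub>R v) x p"
proof -
  let ?M = "real_model f g (\<lambda>v. (1 / \<gamma>) *\<^sub>R v) x"
  define q where "q z = real_of_ereal (f x) + grad f x \<bullet> (z - x) + (norm (z - x))\<^sup>2 / (2 * \<gamma>)" for z
  have M: "?M z = q z + real_of_ereal (g z)" for z
    unfolding real_model_def q_def by (simp add: power2_norm_eq_inner)
  define K where "K = real_of_ereal (f x) + c + w \<bullet> x"
  define W where "W = norm (grad f x + w)"
  have lower: "K - W * norm (z - x) + (norm (z - x))\<^sup>2 / (2 * \<gamma>) \<le> ?M z" if "z \<in> edom g" for z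
  proof -
    have "- (W * norm (z - x)) \<le> (grad f x + w) \<bullet> (z - x)"
      unfolding W_def using Cauchy_Schwarz_ineq2[of "grad f x + w" "z - x"] by linarith
    then show ?thesis
      using minorant[OF that] unfolding M q_def K_def by (simp add: inner_simps)
  qed
  have complete_square: "- W\<^sup>2 * \<gamma> / 2 \<le> - W * t + t\<^sup>2 / (2 * \<gamma>)" for t
  proof -
    have "0 \<le> (t - W * \<gamma>)\<^sup>2 / (2 * \<gamma>)" using \<gamma> by simp
    also have "\<dots> = - W * t + t\<^sup>2 / (2 * \<gamma>) + W\<^sup>2 * \<gamma> / 2"
      using \<gamma> by (simp add: power2_eq_square field_simps)
    finally show ?thesis by simp
  qed
  have bdd: "bdd_below (?M ` edom g)"
  proof (rule bdd_belowI2)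
    fix z assume "z \<in> edom g"
    then show "K - W\<^sup>2 * \<gamma> / 2 \<le> ?M z"
      using lower[of z] complete_square[of "norm (z - x)"] by simp
  qed
  have ne: "?M ` edom g \<noteq> {}" using g(1) by (auto simp: proper_fun_def)
  define m where "m = Inf (?M ` edom g)"
  have "\<exists>z\<in>edom g. ?M z < m + 1 / real (Suc n)" for n
    using cInf_lessD[OF ne, of "m + 1 / real (Suc n)"] unfolding m_def by auto
  then obtain Z where Z: "\<And>n. Z n \<in> edom g" "\<And>n. ?M (Z n) < m + 1 / real (Suc n)"
    by metis
  define S where "S = \<bar>m + 1 - K\<bar>"
  \<comment> \<open>Beyond this radius the quadratic term exceeds the sum of the linear term and \<open>S\<close>.\<close>
  have "norm (Z n - x) \<le> 2 * \<gamma> * (W + S) + 1" for n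
  proof (rule ccontr)
    define t where "t = norm (Z n - x)"
    assume "\<not> norm (Z n - x) \<le> 2 * \<gamma> * (W + S) + 1"
    then have t: "t > 2 * \<gamma> * (W + S) + 1" by (simp add: t_def)
    have nn: "0 \<le> W" "0 \<le> S" by (simp_all add: W_def S_def)
    then have "t > 1" using t \<gamma> by (smt (verit) mult_nonneg_nonneg)
    have "W + S < t / (2 * \<gamma>)" using t \<gamma> by (simp add: field_simps)
    then have "t * (W + S) < t * (t / (2 * \<gamma>))"
      using \<open>t > 1\<close> by (intro mult_strict_left_mono) auto
    moreover have "S \<le> t * S" using \<open>t > 1\<close> nn by (simp add: mult_le_cancel_right1)
    ultimately have "W * t + S < t\<^sup>2 / (2 * \<gamma>)"
      by (simp add: power2_eq_square algebra_simps)
    moreover have "1 / real (Suc n) \<le> 1" by simp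
    ultimately show False
      using lower[OF Z(1)[of n]] Z(2)[of n] unfolding t_def[symmetric] S_def by linarith
  qed
  then have "bounded (range (\<lambda>n. Z n - x))" by (auto simp: bounded_iff)
  then obtain l r where r: "strict_mono r" and "((\<lambda>n. Z n - x) \<circ> r) \<longlonglongrightarrow> l"
    using bounded_imp_convergent_subsequence by blast
  then have lim: "(\<lambda>n. Z (r n)) \<longlonglongrightarrow> l + x"
    using tendsto_add[of "(\<lambda>n. Z n - x) \<circ> r" l sequentially "\<lambda>_. x" x] by simp
  define p where "p = l + x"
  have "(\<lambda>n. 1 / real (Suc n)) \<longlonglongrightarrow> 0"
    using LIMSEQ_inverse_real_of_nat by (simp add: inverse_eq_divide)
  then have "(\<lambda>n. 1 / real (Suc (r n))) \<longlonglongrightarrow> 0"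
    using LIMSEQ_subseq_LIMSEQ[OF _ r] by (fastforce simp: o_def)
  then have "(\<lambda>n. m + 1 / real (Suc (r n)) - q (Z (r n))) \<longlonglongrightarrow> m + 0 - q p"
    unfolding q_def p_def using \<gamma> by (intro tendsto_intros lim) auto
  moreover have "g (Z (r n)) \<le> ereal (m + 1 / real (Suc (r n)) - q (Z (r n)))" for n
    using Z(2)[of "r n"] edom_ereal[OF g(1) Z(1)[of "r n"]] unfolding M
    by (metis ereal_less_eq(3) less_eq_real_def le_diff_eq add.commute)
  ultimately have gp: "g p \<le> ereal (m + 0 - q p)"
    using lsc_fun_sequence_bound[OF g(2) lim] unfolding p_def by blast
  then have p: "p \<in> edom g" unfolding edom_def by (cases "g p") auto
  then have "?M p \<le> m"
    using gp edom_ereal[OF g(1) p] unfolding M by (metis add.commute add_0_right ereal_less_eq(3) le_diff_eq)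
  moreover have "m \<le> ?M z" if "z \<in> edom g" for z
    unfolding m_def using bdd that by (intro cInf_lower) auto
  ultimately have "model_minimizer f g (\<lambda>v. (1 / \<gamma>) *\<^sub>R v) x p"
    using p order_trans unfolding model_minimizer_def by blast
  with that show thesis .
qed

lemma FBE_eq_INF_prox_model:
  assumes "x \<in> closure (edom g)" "\<bar>f x\<bar> \<noteq> \<infinity>"
  shows "FBE f g \<gamma> x = (INF z. prox_model f g (\<lambda>v. (1 / \<gamma>) *\<^sub>R v) x z)"
proof -
  have "g z + ereal (grad f x \<bullet> (z - x)) + ereal (1 / (2 * \<gamma>) * (norm (z - x))\<^sup>2) + f x
      = prox_model f g (\<lambda>v. (1 / \<gamma>) *\<^sub>R v) x z" for z
    unfolding prox_model_def power2_norm_eq_inner by (simp add: ac_simps)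
  then show ?thesis using assms by (simp add: FBE_def)
qed

lemma FBE_lower_bound:
  assumes "x \<in> closure (edom g)" "\<bar>f x\<bar> \<noteq> \<infinity>" "proper_fun g"
    and "\<And>z. z \<in> edom g \<Longrightarrow> B \<le> real_model f g (\<lambda>v. (1 / \<gamma>) *\<^sub>R v) x z"
  shows "ereal B \<le> FBE f g \<gamma> x"
  unfolding FBE_eq_INF_prox_model[where f=f, OF assms(1,2)]
proof (rule INF_greatest)
  fix z show "ereal B \<le> prox_model f g (\<lambda>v. (1 / \<gamma>) *\<^sub>R v) x z"
    using prox_model_real[where f=f, OF assms(2,3)] prox_model_outside[where f=f, OF assms(2)] assms(4)
    by (cases "z \<in> edom g") auto
qed

lemma FBE_upper_bound:
  assumes "x \<in> closure (edom g)" "\<bar>f x\<bar> \<noteq> \<infinity>" "proper_fun g" "z \<in> edom g"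
  shows "FBE f g \<gamma> x \<le> ereal (real_model f g (\<lambda>v. (1 / \<gamma>) *\<^sub>R v) x z)"
  unfolding FBE_eq_INF_prox_model[where f=f, OF assms(1,2)]
  using prox_model_real[where f=f, OF assms(2,3,4)] by (metis INF_lower UNIV_I)

lemma FBE_minimizer:
  assumes "x \<in> closure (edom g)" "\<bar>f x\<bar> \<noteq> \<infinity>" "proper_fun g"
    and "model_minimizer f g (\<lambda>v. (1 / \<gamma>) *\<^sub>R v) x p"
  shows "FBE f g \<gamma> x = ereal (real_model f g (\<lambda>v. (1 / \<gamma>) *\<^sub>R v) x p)"
  using assms FBE_lower_bound[where f=f, OF assms(1-3)] FBE_upper_bound[where f=f, OF assms(1-3)]
  by (meson antisym model_minimizer_def)

lemma linear_scale: "linear (\<lambda>v::'a::real_vector. c *\<^sub>R v)"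
  by (simp add: linear_iff scaleR_add_right)

text \<open>The change of a model with metric \<open>c\<close> times the identity when its base point moves by \<open>h\<close> and its
  gradient by \<open>d\<close>, at the point with offset \<open>w\<close> from a point \<open>a\<close> away from the old base point.\<close>

lemma quadratic_shift_identity:
  fixes u d w a h :: "'a::real_inner" and c :: real
  shows "((u + d) \<bullet> (w + a - h) + 1/2 * ((w + a - h) \<bullet> c *\<^sub>R (w + a - h)))
      - (u \<bullet> (w + a) + 1/2 * ((w + a) \<bullet> c *\<^sub>R (w + a)))
    = - (u \<bullet> h) + d \<bullet> a - c * (h \<bullet> a) + w \<bullet> (d - c *\<^sub>R h) - d \<bullet> h + c / 2 * (h \<bullet> h)"
  by (simp add: inner_add_left inner_add_right inner_diff_left inner_diff_right inner_commute
      algebra_simps)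

text \<open>Half of the differentiability of the envelope: its gradient at \<open>x\<close>, relative to the closure of the domain of \<open>g\<close>,
  is \<open>adjoint H (p - x) + (x - p) / \<gamma>\<close> with \<open>H\<close> the derivative of \<open>\<nabla>f\<close> and \<open>p\<close> the proximal point. Only the lower
  expansion enters a regular subgradient. For it no minimizer of the model at \<open>x'\<close> is compared: for every \<open>y\<close>,
  the models at \<open>x'\<close> and \<open>x\<close> differ at \<open>y\<close> by the expected linear term, terms of higher order, and
  \<open>(y - p) \<bullet> b\<close> with \<open>b\<close> of order \<open>x' - x\<close>; the growth \<open>(norm (y - p))\<^sup>2 / (2 * \<gamma>)\<close> of the model at \<open>x\<close>
  absorbs the latter up to a term of second order. Outside the closure the envelope is infinite, so boundary
  points require nothing extra.\<close>

lemma FBE_lower_expansion: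
  fixes f g :: "'a::euclidean_space \<Rightarrow> ereal"
  assumes g: "proper_fun g" "convex_fun g" and \<gamma>: "\<gamma> > 0"
    and U: "open U" "closure (edom g) \<subseteq> U" "\<And>z. z \<in> U \<Longrightarrow> \<bar>f z\<bar> \<noteq> \<infinity>"
    and x: "x \<in> closure (edom g)"
    and df: "GDERIV (\<lambda>z. real_of_ereal (f z)) x :> grad f x"
    and H: "(grad f has_derivative H) (at x)"
    and p: "model_minimizer f g (\<lambda>v. (1 / \<gamma>) *\<^sub>R v) x p"
    and e: "e > 0"
  shows "\<forall>\<^sub>F x' in nhds x. FBE f g \<gamma> x
      + ereal ((adjoint H (p - x) + (1 / \<gamma>) *\<^sub>R (x - p)) \<bullet> (x' - x) - e * norm (x' - x)) \<le> FBE f g \<gamma> x'"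
proof -
  let ?M = "real_model f g (\<lambda>v. (1 / \<gamma>) *\<^sub>R v)"
  let ?f = "\<lambda>z. real_of_ereal (f z)"
  have Hlin: "bounded_linear H" using H by (rule has_derivative_bounded_linear)
  define K where "K = onorm H"
  have K: "K \<ge> 0" unfolding K_def using Hlin by (rule onorm_pos_le)
  define B where "B = 1 + norm (p - x) + \<gamma> / 2 * (K + 1 + 1 / \<gamma>)\<^sup>2 + (K + 1)"
  have B: "B > 0" unfolding B_def using K \<gamma> by (smt (verit) divide_pos_pos mult_nonneg_nonneg norm_ge_zero zero_le_power2)
  define e1 where "e1 = min 1 (e / B)"
  have e1: "e1 > 0" "e1 \<le> 1" "e1 * B \<le> e" unfolding e1_def using e B by (auto simp: min_def field_simps)
  have near_f: "\<forall>\<^sub>F x' in nhds x. \<bar>?f x' - ?f x - grad f x \<bullet> (x' - x)\<bar> \<le> e1 * norm (x' - x)"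
    using df e1(1) unfolding gderiv_def has_derivative_at_alt eventually_nhds_metric dist_norm
    by (auto simp: inner_commute)
  have near_grad: "\<forall>\<^sub>F x' in nhds x. norm (grad f x' - grad f x - H (x' - x)) \<le> e1 * norm (x' - x)"
    using H e1(1) unfolding has_derivative_at_alt eventually_nhds_metric dist_norm by auto
  have small: "\<forall>\<^sub>F x' in nhds x. norm (x' - x) \<le> e1"
    unfolding eventually_nhds_metric dist_norm using e1(1) by (auto intro!: exI[of _ e1])
  from near_f near_grad small show ?thesis
  proof eventually_elim
    case (elim x')
    define h where "h = x' - x"
    define d where "d = grad f x' - grad f x"
    have h: "norm h \<le> e1" using elim(3) by (simp add: h_def)
    have dH: "norm (d - H h) \<le> e1 * norm h" using elim(2) by (simp add: h_def d_def)
    have "norm d \<le> norm (d - H h) + norm (H h)" by (metis add.commute norm_triangle_sub)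
    also have "\<dots> \<le> (K + 1) * norm h"
    proof -
      have "norm (H h) \<le> K * norm h" unfolding K_def by (rule onorm[OF Hlin])
      moreover have "e1 * norm h \<le> 1 * norm h" using e1 by (intro mult_right_mono) auto
      ultimately show ?thesis using dH by (simp add: algebra_simps)
    qed
    finally have d: "norm d \<le> (K + 1) * norm h" .
    have hh: "norm h * norm h \<le> e1 * norm h" using h by (intro mult_right_mono) auto
    show ?case
    proof (cases "x' \<in> closure (edom g)")
      case True
      let ?v = "adjoint H (p - x) + (1 / \<gamma>) *\<^sub>R (x - p)"
      have M_le: "?M x p + (?v \<bullet> h - e * norm h) \<le> ?M x' y" if y: "y \<in> edom g" for y
      proof -
        define w where "w = y - p"
        define b where "b = d - (1 / \<gamma>) *\<^sub>R h"
        have "?M x p + (norm w)\<^sup>2 / (2 * \<gamma>) \<le> ?M x y"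
          using model_growth[OF g linear_scale p y] by (simp add: w_def power2_norm_eq_inner)
        moreover have "?M x' y - ?M x y = (?f x' - ?f x - grad f x \<bullet> h) + d \<bullet> (p - x)
            - (1 / \<gamma>) * (h \<bullet> (p - x)) + w \<bullet> b - d \<bullet> h + (h \<bullet> h) / (2 * \<gamma>)"
        proof -
          have y_eq: "y - x' = w + (p - x) - h" "y - x = w + (p - x)"
            by (simp_all add: w_def h_def)
          have grad_eq: "grad f x' = grad f x + d" by (simp add: d_def)
          show ?thesis
            unfolding real_model_def y_eq grad_eq b_def
            using quadratic_shift_identity[of "grad f x" d w "p - x" h "1 / \<gamma>"] by simp
        qed
        moreover have "?v \<bullet> h = H h \<bullet> (p - x) - (1 / \<gamma>) * (h \<bullet> (p - x))"
          using adjoint_works[OF bounded_linear.linear[OF Hlin], of h "p - x"]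
          by (simp add: inner_commute inner_add_left inner_add_right inner_diff_left inner_diff_right algebra_simps diff_divide_distrib)
        moreover have "- (e1 * norm h * norm (p - x)) \<le> d \<bullet> (p - x) - H h \<bullet> (p - x)"
        proof -
          have "\<bar>(d - H h) \<bullet> (p - x)\<bar> \<le> norm (d - H h) * norm (p - x)" by (rule Cauchy_Schwarz_ineq2)
          also have "\<dots> \<le> e1 * norm h * norm (p - x)" using dH by (intro mult_right_mono) auto
          finally show ?thesis by (simp add: inner_diff_left)
        qed
        moreover have "- (\<gamma> / 2 * ((K + 1 + 1 / \<gamma>)\<^sup>2 * (e1 * norm h))) \<le> (norm w)\<^sup>2 / (2 * \<gamma>) + w \<bullet> b"
        proof -
          have "0 \<le> (norm (w + \<gamma> *\<^sub>R b))\<^sup>2 / (2 * \<gamma>)" using \<gamma> by simp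
          also have "\<dots> = (norm w)\<^sup>2 / (2 * \<gamma>) + w \<bullet> b + \<gamma> / 2 * (norm b)\<^sup>2"
            using \<gamma> by (simp add: power2_norm_eq_inner inner_simps inner_commute field_simps)
          finally have "- (\<gamma> / 2 * (norm b)\<^sup>2) \<le> (norm w)\<^sup>2 / (2 * \<gamma>) + w \<bullet> b" by simp
          moreover have "(norm b)\<^sup>2 \<le> (K + 1 + 1 / \<gamma>)\<^sup>2 * (e1 * norm h)"
          proof -
            have "norm b \<le> norm d + norm ((1 / \<gamma>) *\<^sub>R h)" unfolding b_def by (rule norm_triangle_ineq4)
            also have "\<dots> \<le> (K + 1 + 1 / \<gamma>) * norm h" using d \<gamma> by (simp add: algebra_simps)
            finally have "(norm b)\<^sup>2 \<le> ((K + 1 + 1 / \<gamma>) * norm h)\<^sup>2" by (intro power_mono) auto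
            also have "\<dots> = (K + 1 + 1 / \<gamma>)\<^sup>2 * (norm h * norm h)" by (simp add: power2_eq_square)
            also have "\<dots> \<le> (K + 1 + 1 / \<gamma>)\<^sup>2 * (e1 * norm h)" using hh by (intro mult_left_mono) auto
            finally show ?thesis .
          qed
          then have "\<gamma> / 2 * (norm b)\<^sup>2 \<le> \<gamma> / 2 * ((K + 1 + 1 / \<gamma>)\<^sup>2 * (e1 * norm h))"
            using \<gamma> by (intro mult_left_mono) auto
          ultimately show ?thesis by linarith
        qed
        moreover have "d \<bullet> h \<le> (K + 1) * (e1 * norm h)"
        proof -
          have "d \<bullet> h \<le> norm d * norm h" by (rule norm_cauchy_schwarz)
          also have "\<dots> \<le> (K + 1) * norm h * norm h" using d by (intro mult_right_mono) auto
          also have "\<dots> \<le> (K + 1) * (e1 * norm h)"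
            using hh K unfolding mult.assoc by (intro mult_left_mono) auto
          finally show ?thesis .
        qed
        moreover have "- (e1 * norm h) \<le> ?f x' - ?f x - grad f x \<bullet> h"
          using elim(1) by (simp add: h_def)
        moreover have "0 \<le> (h \<bullet> h) / (2 * \<gamma>)" using \<gamma> by simp
        moreover have "e1 * B * norm h \<le> e * norm h" using e1(3) by (intro mult_right_mono) auto
        then have "e1 * norm h + e1 * norm h * norm (p - x)
            + \<gamma> / 2 * ((K + 1 + 1 / \<gamma>)\<^sup>2 * (e1 * norm h)) + (K + 1) * (e1 * norm h) \<le> e * norm h"
          unfolding B_def by (simp add: algebra_simps)
        ultimately show ?thesis by linarith
      qed
      have "\<bar>f x'\<bar> \<noteq> \<infinity>" using U(3) subsetD[OF U(2) True] .
      then have "ereal (?M x p + (?v \<bullet> h - e * norm h)) \<le> FBE f g \<gamma> x'"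
        using M_le by (rule FBE_lower_bound[OF True _ g(1)])
      moreover have "FBE f g \<gamma> x = ereal (?M x p)"
        using FBE_minimizer[OF x U(3)[OF subsetD[OF U(2) x]] g(1) p] .
      ultimately show ?thesis by (simp add: h_def)
    next
      case False
      then show ?thesis by (simp add: FBE_def)
    qed
  qed
qed

text \<open>The terms \<open>L / 2 * (norm (y - x))\<^sup>2\<close> and \<open>t\<^sup>2\<close> are convex and thus lie above their linearizations, so their gradients
  simply add to a regular subgradient \<open>v\<close> of the envelope.\<close>

lemma potential_regular_subgradient:
  fixes f g :: "'a::euclidean_space \<Rightarrow> ereal"
  assumes fin: "\<bar>FBE f g \<gamma> x\<bar> \<noteq> \<infinity>" and L: "L \<ge> 0"
    and lower: "\<And>e. e > 0 \<Longrightarrow> \<forall>\<^sub>F x' in nhds x.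
      FBE f g \<gamma> x + ereal (v \<bullet> (x' - x) - e * norm (x' - x)) \<le> FBE f g \<gamma> x'"
  shows "(v - L *\<^sub>R (y - x), L *\<^sub>R (y - x), 2 * t) \<in> regular_subdiff (potential f g L \<gamma>) (x, y, t)"
proof (rule regular_subdiffI)
  obtain r where r: "FBE f g \<gamma> x = ereal r" using fin by auto
  then show "\<bar>potential f g L \<gamma> (x, y, t)\<bar> \<noteq> \<infinity>" by (simp add: potential_def)
  fix e :: real assume e: "e > 0"
  let ?z = "(x, y, t)" and ?v = "(v - L *\<^sub>R (y - x), L *\<^sub>R (y - x), 2 * t)"
  have "(fst \<longlongrightarrow> x) (at ?z)" using tendsto_fst[OF tendsto_ident_at, of ?z UNIV] by simp
  from eventually_compose_filterlim[OF lower[OF e] this]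
  show "\<forall>\<^sub>F z' in at ?z. potential f g L \<gamma> ?z + ereal (?v \<bullet> (z' - ?z) - e * norm (z' - ?z))
      \<le> potential f g L \<gamma> z'"
  proof eventually_elim
    case (elim z')
    obtain x' y' t' where z': "z' = (x', y', t')" by (cases z') auto
    have nle: "norm (x' - x) \<le> norm (z' - ?z)"
      unfolding z' by (simp add: norm_Pair real_le_rsqrt)
    have "e * norm (x' - x) \<le> e * norm (z' - ?z)" using nle e by (intro mult_left_mono) auto
    moreover have "L / 2 * (norm (y - x))\<^sup>2 + L * ((y - x) \<bullet> ((y' - x') - (y - x))) \<le> L / 2 * (norm (y' - x'))\<^sup>2"
    proof -
      define a b where "a = y - x" and "b = y' - x'"
      have "0 \<le> L / 2 * (norm (b - a))\<^sup>2" using L by simp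
      also have "\<dots> = L / 2 * (norm b)\<^sup>2 - L / 2 * (norm a)\<^sup>2 - L * (a \<bullet> (b - a))"
        by (simp add: power2_norm_eq_inner inner_simps inner_commute algebra_simps)
      finally show ?thesis by (simp add: a_def b_def)
    qed
    moreover have "t\<^sup>2 + 2 * t * (t' - t) \<le> t'\<^sup>2"
    proof -
      have "0 \<le> (t' - t)\<^sup>2" by simp
      then show ?thesis by (simp add: power2_eq_square algebra_simps)
    qed
    moreover have "?v \<bullet> (z' - ?z)
        = v \<bullet> (x' - x) + L * ((y - x) \<bullet> ((y' - x') - (y - x))) + 2 * t * (t' - t)"
      unfolding z' by (simp add: inner_simps algebra_simps)
    ultimately have "r + L / 2 * (norm (y - x))\<^sup>2 + t\<^sup>2 + (?v \<bullet> (z' - ?z) - e * norm (z' - ?z))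
      \<le> (r + (v \<bullet> (x' - x) - e * norm (x' - x))) + (L / 2 * (norm (y' - x'))\<^sup>2 + t'\<^sup>2)"
      by linarith
    then have "potential f g L \<gamma> ?z + ereal (?v \<bullet> (z' - ?z) - e * norm (z' - ?z))
      \<le> ereal (r + (v \<bullet> (x' - x) - e * norm (x' - x))) + ereal (L / 2 * (norm (y' - x'))\<^sup>2 + t'\<^sup>2)"
      by (simp add: potential_def r)
    also have "\<dots> \<le> FBE f g \<gamma> x' + ereal (L / 2 * (norm (y' - x'))\<^sup>2 + t'\<^sup>2)"
      using elim unfolding z' r by (intro add_right_mono) simp
    also have "\<dots> = potential f g L \<gamma> z'"
      by (simp add: potential_def z' add.assoc)
    finally show ?case .
  qed
qed

section \<open>Adjoints, the descent lemma and the KL inequality along a sequence\<close>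

lemma norm_adjoint_blinfun_le:
  fixes H :: "'a::euclidean_space \<Rightarrow>\<^sub>L 'a"
  shows "norm (adjoint (blinfun_apply H) q) \<le> norm H * norm q"
proof -
  let ?a = "adjoint (blinfun_apply H) q"
  have "norm ?a * norm ?a = blinfun_apply H ?a \<bullet> q"
    using adjoint_works[OF bounded_linear.linear[OF blinfun.bounded_linear_right], of ?a H q]
    by (simp add: power2_norm_eq_inner[symmetric] power2_eq_square[symmetric])
  also have "\<dots> \<le> norm (blinfun_apply H ?a) * norm q" by (rule norm_cauchy_schwarz)
  also have "\<dots> \<le> norm H * norm ?a * norm q"
    by (intro mult_right_mono norm_blinfun) auto
  finally have "norm ?a * norm ?a \<le> norm ?a * (norm H * norm q)" by (simp add: mult_ac)
  then show ?thesis by (cases "norm ?a = 0") auto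
qed

lemma lipschitz_gradient_descent:
  fixes \<phi> :: "'a::euclidean_space \<Rightarrow> real"
  assumes "convex S" and lip: "L-lipschitz_on S \<phi>'"
    and deriv: "\<And>z. z \<in> S \<Longrightarrow> GDERIV \<phi> z :> \<phi>' z" and ab: "a \<in> S" "b \<in> S"
  shows "\<phi> b \<le> \<phi> a + \<phi>' a \<bullet> (b - a) + L / 2 * (norm (b - a))\<^sup>2"
proof -
  define u where "u = b - a"
  define \<psi> where "\<psi> s = \<phi> (a + s *\<^sub>R u) - s * (\<phi>' a \<bullet> u) - L / 2 * s\<^sup>2 * (norm u)\<^sup>2" for s
  have "\<psi> 1 \<le> \<psi> 0"
  proof (rule DERIV_nonpos_imp_nonincreasing[OF zero_le_one])
    fix s :: real assume s: "0 \<le> s" "s \<le> 1"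
    have c: "a + s *\<^sub>R u \<in> S"
    proof -
      have "(1 - s) *\<^sub>R a + s *\<^sub>R b \<in> S" using s ab \<open>convex S\<close> by (simp add: convexD_alt)
      then show ?thesis by (simp add: u_def algebra_simps)
    qed
    have "(\<phi> has_derivative (\<lambda>h. h \<bullet> \<phi>' (a + s *\<^sub>R u))) (at (a + s *\<^sub>R u))"
      using deriv[OF c] by (simp add: gderiv_def)
    then have "((\<lambda>s. \<phi> (a + s *\<^sub>R u)) has_derivative (\<lambda>h. (h *\<^sub>R u) \<bullet> \<phi>' (a + s *\<^sub>R u))) (at s)"
      by (rule has_derivative_compose[rotated]) (auto intro!: derivative_eq_intros)
    then have "((\<lambda>s. \<phi> (a + s *\<^sub>R u)) has_real_derivative \<phi>' (a + s *\<^sub>R u) \<bullet> u) (at s)"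
      by (simp add: has_field_derivative_def inner_commute mult_commute_abs)
    then have "(\<psi> has_real_derivative
        \<phi>' (a + s *\<^sub>R u) \<bullet> u - \<phi>' a \<bullet> u - L * s * (norm u)\<^sup>2) (at s)"
      unfolding \<psi>_def by (auto intro!: derivative_eq_intros simp: algebra_simps)
    moreover have "\<phi>' (a + s *\<^sub>R u) \<bullet> u - \<phi>' a \<bullet> u - L * s * (norm u)\<^sup>2 \<le> 0"
    proof -
      have "(\<phi>' (a + s *\<^sub>R u) - \<phi>' a) \<bullet> u \<le> norm (\<phi>' (a + s *\<^sub>R u) - \<phi>' a) * norm u"
        by (rule norm_cauchy_schwarz)
      also have "\<dots> \<le> L * (s * norm u) * norm u"
        using lipschitz_onD[OF lip c ab(1)] s by (intro mult_right_mono) (auto simp: dist_norm)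
      finally show ?thesis by (simp add: inner_diff_left power2_eq_square algebra_simps)
    qed
    ultimately show "\<exists>D. (\<psi> has_real_derivative D) (at s) \<and> D \<le> 0" by blast
  qed
  then show ?thesis by (simp add: \<psi>_def u_def)
qed

text \<open>The form of the KL inequality used along a sequence: a subgradient bounds the distance of the
  subdifferential from the origin, and \<open>\<phi>' s = c * (1 - \<theta>) * s powr (- \<theta>)\<close>.\<close>

lemma KL_inequality:
  assumes KL: "KL_function_on Z h \<theta>" and zb: "zb \<in> Z" "limiting_subdiff h zb \<noteq> {}" "h zb = ereal s"
    and z: "z \<longlonglongrightarrow> zb" "\<And>n. z n \<in> Z" and P: "\<And>n. h (z n) = ereal (P n)" "P \<longlonglongrightarrow> s" "\<And>n. s < P n"
    and v: "\<And>n. v n \<in> limiting_subdiff h (z n)" and \<theta>: "\<theta> < 1"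
  obtains c where "c > 0" "\<forall>\<^sub>F n in sequentially. (P n - s) powr \<theta> \<le> c * norm (v n)"
proof -
  have "KL_property_on Z h \<theta> zb" using KL zb by (simp add: KL_function_on_def)
  then obtain \<delta> c :: real and \<omega> :: ereal where pos: "\<delta> > 0" "c > 0" "0 < \<omega>"
    and ineq: "\<And>z. z \<in> Z \<Longrightarrow> norm (z - zb) \<le> \<delta> \<Longrightarrow> h zb < h z \<Longrightarrow> h z < h zb + \<omega> \<Longrightarrow>
      1 \<le> ereal (deriv (\<lambda>s. c * s powr (1 - \<theta>)) (real_of_ereal (h z - h zb)))
         * edist0 (limiting_subdiff h z)"
    unfolding KL_property_on_def by metis
  have near: "\<forall>\<^sub>F n in sequentially. dist (z n) zb < \<delta>"
    using tendstoD[OF z(1) pos(1)] .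
  have "ereal s < ereal s + \<omega>" using pos(3) by (cases \<omega>) auto
  then have small: "\<forall>\<^sub>F n in sequentially. ereal (P n) < ereal s + \<omega>"
    using order_tendstoD(2)[OF tendsto_ereal[OF P(2)]] by blast
  from near small have "\<forall>\<^sub>F n in sequentially. (P n - s) powr \<theta> \<le> c * (1 - \<theta>) * norm (v n)"
  proof eventually_elim
    case (elim n)
    let ?s = "P n - s"
    have s: "?s > 0" using P(3)[of n] by simp
    have "((\<lambda>s. c * s powr (1 - \<theta>)) has_real_derivative c * (1 - \<theta>) * ?s powr (- \<theta>)) (at ?s)"
      using s by (auto intro!: derivative_eq_intros)
    then have "deriv (\<lambda>s. c * s powr (1 - \<theta>)) ?s = c * (1 - \<theta>) * ?s powr (- \<theta>)"
      by (rule DERIV_imp_deriv)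
    then have "1 \<le> ereal (c * (1 - \<theta>) * ?s powr (- \<theta>)) * edist0 (limiting_subdiff h (z n))"
      using ineq[OF z(2)[of n]] elim P(3)[of n] unfolding P(1) zb(3) by (simp add: dist_norm)
    also have "\<dots> \<le> ereal (c * (1 - \<theta>) * ?s powr (- \<theta>)) * ereal (norm (v n))"
      unfolding edist0_def using v[of n] pos \<theta> by (intro ereal_mult_left_mono INF_lower) auto
    finally have "1 \<le> c * (1 - \<theta>) * ?s powr (- \<theta>) * norm (v n)" by (simp add: one_ereal_def)
    then show ?case using s by (simp add: powr_minus field_simps)
  qed
  moreover have "c * (1 - \<theta>) > 0" using pos \<theta> by simp
  ultimately show thesis using that by blast
qed

section \<open>Descent of the line-search method\<close>

text \<open>Convexity of \<open>\<Gamma>\<close> makes the Lipschitz constant \<open>L\<close> valid on the segments searched by the method, and its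
  compactness supplies cluster points and bounds the second derivative of \<open>f\<close> along the iterates.\<close>

locale bounded_VMiPG_run =
  fixes f g :: "'a::euclidean_space \<Rightarrow> ereal"
    and U \<Gamma> :: "'a set"
    and \<mu> \<mu>' \<beta> \<sigma> L \<gamma> :: real
    and \<epsilon> :: "nat \<Rightarrow> real"
    and G :: "nat \<Rightarrow> 'a \<Rightarrow> 'a"
    and x y :: "nat \<Rightarrow> 'a"
  assumes g_proper: "proper_fun g" and g_lsc: "lsc_fun g" and g_convex: "convex_fun g"
    and g_cont: "continuous_on (edom g) g"
    and U: "open U" "closure (edom g) \<subseteq> U" "C2_on U f"
    and F_bounded_below: "(INF z. f z + g z) > -\<infinity>"
    and mu: "\<mu> > 0"
    and beta: "\<beta> \<in> {0<..<1}"
    and sigma: "\<sigma> \<in> {0<..<1/2 * min 1 \<mu>}"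
    and eps: "\<forall>k. \<epsilon> k > 0" "bounded (range \<epsilon>)"
    and generated: "VMiPG f g \<mu> \<beta> \<sigma> \<epsilon> G x y"
    and mu': "\<mu>' > 0" "\<forall>k. onorm (G k) \<le> \<mu>'"
    and Gamma: "compact \<Gamma>" "convex \<Gamma>" "range x \<union> range y \<subseteq> \<Gamma>" "\<Gamma> \<subseteq> U"
    and L: "L > 0" "L-lipschitz_on \<Gamma> (grad f)"
    and gamma: "\<gamma> \<in> {0<..1 / \<mu>'}"
begin

definition Freal :: "'a \<Rightarrow> real" where
  "Freal z = real_of_ereal (f z) + real_of_ereal (g z)"

abbreviation step :: "nat \<Rightarrow> 'a" where "step k \<equiv> y k - x k"

abbreviation prox :: "'a \<Rightarrow> 'a" where "prox v \<equiv> (1 / \<gamma>) *\<^sub>R v"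

lemma f_finite: "z \<in> U \<Longrightarrow> \<bar>f z\<bar> \<noteq> \<infinity>"
  and f_gderiv: "z \<in> U \<Longrightarrow> GDERIV (\<lambda>z. real_of_ereal (f z)) z :> grad f z"
  using U(3) by (auto simp: C2_on_def)

lemma edom_U: "z \<in> edom g \<Longrightarrow> z \<in> U"
  using U(2) closure_subset by blast

lemma Freal: "z \<in> edom g \<Longrightarrow> f z + g z = ereal (Freal z)"
proof -
  assume z: "z \<in> edom g"
  obtain r s where "f z = ereal r" "g z = ereal s"
    using f_finite[OF edom_U[OF z]] edom_ereal[OF g_proper z] by auto
  then show ?thesis by (simp add: Freal_def)
qed

lemma G_self_adjoint: "self_adjoint (G k)"
  and G_linear: "linear (G k)"
  and G_lower: "\<mu> * (norm v)\<^sup>2 \<le> v \<bullet> G k v"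
  and G_norm: "norm (G k v) \<le> \<mu>' * norm v"
  and G_upper: "v \<bullet> G k v \<le> \<mu>' * (norm v)\<^sup>2"
proof -
  show sa: "self_adjoint (G k)" using generated by (simp add: VMiPG_def)
  then show lin: "linear (G k)" by (simp add: self_adjoint_def)
  have "0 \<le> v \<bullet> (G k v - \<mu> *\<^sub>R v)"
    using generated by (simp add: VMiPG_def loewner_ge_def)
  then show "\<mu> * (norm v)\<^sup>2 \<le> v \<bullet> G k v"
    by (simp add: inner_diff_right power2_norm_eq_inner)
  have "norm (G k v) \<le> onorm (G k) * norm v"
    using lin by (intro onorm) (simp add: linear_conv_bounded_linear)
  also have "\<dots> \<le> \<mu>' * norm v" using mu' by (intro mult_right_mono) auto
  finally show le: "norm (G k v) \<le> \<mu>' * norm v" .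
  have "v \<bullet> G k v \<le> norm v * norm (G k v)" by (rule norm_cauchy_schwarz)
  also have "\<dots> \<le> norm v * (\<mu>' * norm v)" using le by (intro mult_left_mono) auto
  finally show "v \<bullet> G k v \<le> \<mu>' * (norm v)\<^sup>2" by (simp add: power2_eq_square mult_ac)
qed

lemma gamma_pos: "\<gamma> > 0" and mu'_le_gamma: "\<mu>' \<le> 1 / \<gamma>"
  using gamma mu' by (auto simp: field_simps)

lemma iterates_Gamma: "x k \<in> \<Gamma>" "y k \<in> \<Gamma>" and iterates_U: "x k \<in> U" "y k \<in> U"
  using Gamma(3,4) by blast+

lemma inexact_step: "inexact_prox_step f g (\<epsilon> k) (G k) (x k) (y k)"
  and linesearch: "linesearch_update (\<lambda>z. f z + g z) \<beta> \<sigma> (x k) (y k) (x (Suc k))"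
  using generated by (simp_all add: VMiPG_def)

lemma y_edom: "y k \<in> edom g"
proof (rule ccontr)
  assume "y k \<notin> edom g"
  then show False
    using prox_model_outside[where f=f and g=g and x="x k" and G="G k", OF f_finite[OF iterates_U(1)]] inexact_step[of k]
    by (simp add: inexact_prox_step_def)
qed

lemma segment_edom:
  assumes "a \<in> edom g" "b \<in> edom g" "0 \<le> s" "s \<le> 1"
  shows "a + s *\<^sub>R (b - a) \<in> edom g"
proof -
  have "(1 - s) *\<^sub>R a + s *\<^sub>R b \<in> edom g"
    using convex_edom[OF g_proper g_convex] assms by (simp add: convexD_alt)
  then show ?thesis by (simp add: algebra_simps)
qed

lemma beta_power: "0 < \<beta> ^ m" "\<beta> ^ m \<le> 1"
  using beta by (auto intro: power_le_one)

lemma x_edom: "x k \<in> edom g"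
proof (induction k)
  case 0
  then show ?case using generated by (simp add: VMiPG_def)
next
  case (Suc k)
  then show ?case
    using linesearch[of k] y_edom[of k] segment_edom[OF Suc y_edom[of k]] beta_power
    by (auto simp: linesearch_update_def less_imp_le)
qed

lemma trial_edom: "x k + \<beta> ^ m *\<^sub>R step k \<in> edom g"
  using segment_edom[OF x_edom y_edom] beta_power by (simp add: less_imp_le)

lemma model_decrease: "real_model f g (G k) (x k) (y k) < real_model f g (G k) (x k) (x k)"
  using inexact_step[of k] prox_model_real[where f=f, OF f_finite[OF iterates_U(1)] g_proper]
    x_edom y_edom by (simp add: inexact_prox_step_def)

lemma step_nonzero: "step k \<noteq> 0"
  using model_decrease[of k] by auto

lemma linear_decrease:
  "grad f (x k) \<bullet> step k + real_of_ereal (g (y k)) - real_of_ereal (g (x k)) \<le> - \<mu> / 2 * (norm (step k))\<^sup>2"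
  using model_decrease[of k] G_lower[of "step k" k] linear_0[OF G_linear, of k]
  by (simp add: real_model_def)

lemma f_descent:
  assumes "a \<in> \<Gamma>" "b \<in> \<Gamma>"
  shows "real_of_ereal (f b) \<le> real_of_ereal (f a) + grad f a \<bullet> (b - a) + L / 2 * (norm (b - a))\<^sup>2"
  using assms f_gderiv Gamma(4)
  by (intro lipschitz_gradient_descent[OF Gamma(2) L(2)]) auto

lemma sufficient_decrease_iff:
  "sufficient_decrease (\<lambda>z. f z + g z) \<beta> \<sigma> (x k) (step k) m \<longleftrightarrow>
     Freal (x k + \<beta> ^ m *\<^sub>R step k) \<le> Freal (x k) - \<sigma> * \<beta> ^ m * (norm (step k))\<^sup>2"
  unfolding sufficient_decrease_def Freal[OF x_edom] Freal[OF trial_edom] by auto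

text \<open>On the segment from \<open>x k\<close> to \<open>y k\<close>, convexity of \<open>g\<close> and the descent lemma for \<open>f\<close> bound the change of the objective
  by \<open>s * (- \<mu> + L * s) / 2 * (norm (step k))\<^sup>2\<close>; this is the required decrease once \<open>L * s \<le> \<mu> - 2 * \<sigma>\<close>.\<close>

lemma small_steps_accepted:
  assumes small: "L * \<beta> ^ m \<le> \<mu> - 2 * \<sigma>"
  shows "sufficient_decrease (\<lambda>z. f z + g z) \<beta> \<sigma> (x k) (step k) m"
proof -
  define s where "s = \<beta> ^ m"
  have s: "0 < s" "s \<le> 1" using beta_power[of m] by (auto simp: s_def)
  define c where "c = x k + s *\<^sub>R step k"
  have c_eq: "c = (1 - s) *\<^sub>R x k + s *\<^sub>R y k" by (simp add: c_def algebra_simps)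
  have "c \<in> \<Gamma>" unfolding c_eq using Gamma(2) iterates_Gamma s by (simp add: convexD_alt)
  have "real_of_ereal (g c) \<le> (1 - s) * real_of_ereal (g (x k)) + s * real_of_ereal (g (y k))"
  proof (cases "s = 1")
    case False
    then show ?thesis
      unfolding c_eq using s convex_fun_real(2)[OF g_proper g_convex x_edom y_edom] by simp
  qed (simp add: c_eq)
  moreover have "real_of_ereal (f c) \<le> real_of_ereal (f (x k)) + s * (grad f (x k) \<bullet> step k)
      + s * (L * s / 2 * (norm (step k))\<^sup>2)"
    using f_descent[OF iterates_Gamma(1) \<open>c \<in> \<Gamma>\<close>, of k] s
    by (simp add: c_def power_mult_distrib power2_eq_square mult_ac)
  moreover have "s * (grad f (x k) \<bullet> step k + real_of_ereal (g (y k)) - real_of_ereal (g (x k)))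
      \<le> s * (- \<mu> / 2 * (norm (step k))\<^sup>2)"
    using linear_decrease[of k] s by (intro mult_left_mono) auto
  moreover have "s * (L * s / 2 * (norm (step k))\<^sup>2) \<le> s * ((\<mu> - 2 * \<sigma>) / 2 * (norm (step k))\<^sup>2)"
    using small s unfolding s_def[symmetric] by (intro mult_left_mono mult_right_mono) auto
  ultimately have "Freal c \<le> Freal (x k) - \<sigma> * s * (norm (step k))\<^sup>2"
    unfolding Freal_def by (simp add: algebra_simps diff_divide_distrib)
  then show ?thesis by (simp add: sufficient_decrease_iff c_def s_def)
qed

text \<open>A uniform lower bound for the accepted step sizes: if the exponent \<open>m\<close> is positive, then \<open>m - 1\<close> was rejected.\<close>

definition step_bound :: real where
  "step_bound = min 1 (\<beta> * (\<mu> - 2 * \<sigma>) / L)"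

lemma step_bound_pos: "step_bound > 0"
  using beta sigma L by (auto simp: step_bound_def)

lemma sigma_pos: "\<sigma> > 0" using sigma by simp

lemma iteration:
  shows F_decrease: "\<sigma> * step_bound * (norm (step k))\<^sup>2 \<le> Freal (x k) - Freal (x (Suc k))"
    and F_le_trial: "Freal (x (Suc k)) \<le> Freal (y k)"
    and x_step: "norm (x (Suc k) - x k) \<le> norm (step k)"
proof -
  obtain m where acc: "sufficient_decrease (\<lambda>z. f z + g z) \<beta> \<sigma> (x k) (step k) m"
    and min: "\<And>j. j < m \<Longrightarrow> \<not> sufficient_decrease (\<lambda>z. f z + g z) \<beta> \<sigma> (x k) (step k) j"
    and upd: "x (Suc k) = (if f (y k) + g (y k) < f (x k + \<beta>^m *\<^sub>R step k) + g (x k + \<beta>^m *\<^sub>R step k)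
      then y k else x k + \<beta>^m *\<^sub>R step k)"
    using linesearch[of k] unfolding linesearch_update_def by blast
  have upd': "x (Suc k) = (if Freal (y k) < Freal (x k + \<beta>^m *\<^sub>R step k)
      then y k else x k + \<beta>^m *\<^sub>R step k)"
    using upd unfolding Freal[OF y_edom] Freal[OF trial_edom] by simp
  have "step_bound \<le> \<beta> ^ m"
  proof (cases m)
    case (Suc j)
    then have "\<mu> - 2 * \<sigma> < L * \<beta> ^ j"
      using min[of j] small_steps_accepted[of j k] by fastforce
    then have "\<beta> * (\<mu> - 2 * \<sigma>) \<le> \<beta> * (L * \<beta> ^ j)"
      using beta by (intro mult_left_mono) auto
    then have "\<beta> * (\<mu> - 2 * \<sigma>) / L \<le> \<beta> ^ m"
      using L Suc by (simp add: pos_divide_le_eq mult_ac)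
    then show ?thesis by (simp add: step_bound_def)
  qed (simp add: step_bound_def)
  then have "\<sigma> * step_bound * (norm (step k))\<^sup>2 \<le> \<sigma> * \<beta> ^ m * (norm (step k))\<^sup>2"
    using sigma_pos by (intro mult_right_mono mult_left_mono) auto
  then show "\<sigma> * step_bound * (norm (step k))\<^sup>2 \<le> Freal (x k) - Freal (x (Suc k))"
    using acc unfolding sufficient_decrease_iff upd' by auto
  show "Freal (x (Suc k)) \<le> Freal (y k)" unfolding upd' by auto
  have "\<beta> ^ m * norm (step k) \<le> 1 * norm (step k)"
    using beta_power by (intro mult_right_mono) auto
  then show "norm (x (Suc k) - x k) \<le> norm (step k)"
    unfolding upd' using beta_power[of m] by auto
qed

definition Flim :: real where "Flim = lim (\<lambda>k. Freal (x k))"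

lemma F_antitone: "decseq (\<lambda>k. Freal (x k))"
proof (rule decseq_SucI)
  fix k
  have "0 \<le> \<sigma> * step_bound * (norm (step k))\<^sup>2"
    using sigma_pos step_bound_pos by simp
  then show "Freal (x (Suc k)) \<le> Freal (x k)" using F_decrease[of k] by simp
qed

lemma F_tendsto: "(\<lambda>k. Freal (x k)) \<longlonglongrightarrow> Flim"
proof -
  obtain m where m: "ereal m < (INF z. f z + g z)"
    using F_bounded_below ereal_dense2 by blast
  have "m \<le> Freal (x k)" for k
  proof -
    have "ereal m < f (x k) + g (x k)" using m by (meson INF_lower UNIV_I order.strict_trans2)
    then show ?thesis unfolding Freal[OF x_edom] by simp
  qed
  then obtain l where "(\<lambda>k. Freal (x k)) \<longlonglongrightarrow> l"
    using decseq_convergent[OF F_antitone, of m] by blast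
  then show ?thesis unfolding Flim_def by (simp add: limI)
qed

text \<open>Strictness matters: the KL inequality says something only above the limiting value. It holds because
  \<open>y k \<noteq> x k\<close>, by the strict decrease of the model.\<close>

lemma Flim_less: "Flim < Freal (x k)"
proof -
  have "0 < \<sigma> * step_bound * (norm (step k))\<^sup>2"
    using sigma_pos step_bound_pos step_nonzero[of k] by simp
  then have "Freal (x (Suc k)) < Freal (x k)" using F_decrease[of k] by linarith
  moreover have "Flim \<le> Freal (x (Suc k))" by (rule decseq_ge[OF F_antitone F_tendsto])
  ultimately show ?thesis by simp
qed

section \<open>Error bounds in terms of the step\<close>

lemma step_tendsto_0: "step \<longlonglongrightarrow> 0"
proof -
  let ?a = "\<sigma> * step_bound"
  have a: "?a > 0" using sigma_pos step_bound_pos by simp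
  have "(\<lambda>k. (Freal (x k) - Freal (x (Suc k))) / ?a) \<longlonglongrightarrow> (Flim - Flim) / ?a"
    using a by (intro tendsto_intros F_tendsto LIMSEQ_Suc[OF F_tendsto]) auto
  then have lim: "(\<lambda>k. (Freal (x k) - Freal (x (Suc k))) / ?a) \<longlonglongrightarrow> 0" by simp
  have le: "(norm (step k))\<^sup>2 \<le> (Freal (x k) - Freal (x (Suc k))) / ?a" for k
    using F_decrease[of k] a by (simp add: pos_le_divide_eq mult_ac)
  have "(\<lambda>k. (norm (step k))\<^sup>2) \<longlonglongrightarrow> 0"
    by (rule tendsto_sandwich[OF _ _ tendsto_const lim]) (use le in auto)
  then have "(\<lambda>k. norm (step k)) \<longlonglongrightarrow> 0"
    using tendsto_real_sqrt[of "\<lambda>k. (norm (step k))\<^sup>2" 0] by simp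
  then show ?thesis by (rule tendsto_norm_zero_cancel)
qed

lemma step_norm_tendsto_0: "(\<lambda>k. norm (step k)) \<longlonglongrightarrow> 0"
  using tendsto_norm_zero[OF step_tendsto_0] .

definition eps_bound :: real where "eps_bound = Sup (range \<epsilon>)"

lemma eps_le: "\<epsilon> k \<le> eps_bound"
  unfolding eps_bound_def using eps(2) by (intro cSup_upper bounded_imp_bdd_above) auto

lemma eps_bound_pos: "eps_bound > 0"
  using eps(1) eps_le[of 0] less_le_trans by blast

text \<open>Controls the distance from \<open>x k\<close> to the exact minimizer: the inexactness \<open>\<epsilon> k * (norm (step k))\<^sup>2\<close> and the growth
  \<open>\<mu> / 2\<close> of the model bound the distance from \<open>y k\<close> to it.\<close>

definition exact_factor :: real where "exact_factor = 1 + sqrt (2 * eps_bound / \<mu>)"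

lemma exact_factor_pos: "exact_factor > 0"
  unfolding exact_factor_def using eps_bound_pos mu by (simp add: add_pos_nonneg)

lemma exact_minimizer:
  obtains p where "model_minimizer f g (G k) (x k) p"
    "norm (p - x k) \<le> exact_factor * norm (step k)"
    "real_model f g (G k) (x k) (y k) \<le> real_model f g (G k) (x k) p + \<epsilon> k * (norm (step k))\<^sup>2"
proof -
  obtain p where p: "is_arg_min (prox_model f g (G k) (x k)) (\<lambda>_. True) p"
    and inexact: "prox_model f g (G k) (x k) (y k) - prox_model f g (G k) (x k) p
      \<le> ereal (\<epsilon> k * (norm (step k))\<^sup>2)"
    using inexact_step[of k] by (auto simp: inexact_prox_step_def)
  have min: "model_minimizer f g (G k) (x k) p"
    by (rule arg_min_model_minimizer[OF p f_finite[OF iterates_U(1)] g_proper])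
  then have pd: "p \<in> edom g" by (simp add: model_minimizer_def)
  have le: "real_model f g (G k) (x k) (y k) \<le> real_model f g (G k) (x k) p + \<epsilon> k * (norm (step k))\<^sup>2"
    using inexact prox_model_real[where f=f, OF f_finite[OF iterates_U(1)] g_proper] pd y_edom by simp
  have "\<mu> / 2 * (norm (y k - p))\<^sup>2 \<le> \<epsilon> k * (norm (step k))\<^sup>2"
    using model_growth[OF g_proper g_convex G_linear min y_edom[of k]] le G_lower[of "y k - p" k]
    by simp
  also have "\<dots> \<le> eps_bound * (norm (step k))\<^sup>2"
    using eps_le by (intro mult_right_mono) auto
  finally have "(norm (y k - p))\<^sup>2 \<le> 2 * eps_bound / \<mu> * (norm (step k))\<^sup>2"
    using mu by (simp add: field_simps)
  then have "norm (y k - p) \<le> sqrt (2 * eps_bound / \<mu> * (norm (step k))\<^sup>2)"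
    by (rule real_le_rsqrt)
  then have "norm (y k - p) \<le> sqrt (2 * eps_bound / \<mu>) * norm (step k)"
    unfolding real_sqrt_mult by simp
  moreover have "norm (p - x k) \<le> norm (step k) + norm (y k - p)"
    using norm_triangle_ineq4[of "step k" "y k - p"] by simp
  ultimately have "norm (p - x k) \<le> exact_factor * norm (step k)"
    by (simp add: exact_factor_def algebra_simps)
  with min le that show thesis by blast
qed

text \<open>Transfers the estimates from the metric \<open>G k\<close> to the metric \<open>1 / \<gamma>\<close> of the envelope. Write \<open>q\<close>, \<open>p\<close> for the two
  minimizers. Since \<open>0 \<le> G k \<le> \<mu>' \<le> 1 / \<gamma>\<close>, the model in the metric \<open>1 / \<gamma>\<close> is the larger one, and it exceeds
  the other by at most \<open>(norm (z - x k))\<^sup>2 / (2 * \<gamma>)\<close>. Growth of the larger model at \<open>p\<close> and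
  minimality of \<open>q\<close> for the smaller one then give \<open>norm (q - p) \<le> norm (q - x k)\<close>.\<close>

lemma prox_point:
  obtains p where "model_minimizer f g prox (x k) p"
    "norm (p - x k) \<le> 2 * exact_factor * norm (step k)"
    "real_model f g (G k) (x k) (y k) \<le> real_model f g prox (x k) p + \<epsilon> k * (norm (step k))\<^sup>2"
proof -
  obtain q where q: "model_minimizer f g (G k) (x k) q"
    and qx: "norm (q - x k) \<le> exact_factor * norm (step k)"
    and inexact: "real_model f g (G k) (x k) (y k)
      \<le> real_model f g (G k) (x k) q + \<epsilon> k * (norm (step k))\<^sup>2"
    by (rule exact_minimizer)
  have qd: "q \<in> edom g" using q by (simp add: model_minimizer_def)
  let ?s = "grad f (x k) + G k (q - x k)"
  have minorant: "(real_of_ereal (g q) + ?s \<bullet> q) + (- ?s) \<bullet> z \<le> real_of_ereal (g z)" if "z \<in> edom g" for z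
  proof -
    have "(- ?s) \<bullet> z + ?s \<bullet> q = - (?s \<bullet> (z - q))"
      unfolding inner_minus_left inner_diff_right by simp
    then show ?thesis
      using model_minimizer_subgradient[OF g_proper g_convex G_self_adjoint q that] by linarith
  qed
  obtain p where p: "model_minimizer f g prox (x k) p"
    using prox_minimizer_exists[OF g_proper g_lsc gamma_pos minorant] by blast
  have pd: "p \<in> edom g" using p by (simp add: model_minimizer_def)
  have diff: "real_model f g prox (x k) z - real_model f g (G k) (x k) z
      = (norm (z - x k))\<^sup>2 / (2 * \<gamma>) - 1/2 * ((z - x k) \<bullet> G k (z - x k))" for z
    by (simp add: real_model_def power2_norm_eq_inner)
  have "\<mu>' * (norm (p - x k))\<^sup>2 \<le> 1 / \<gamma> * (norm (p - x k))\<^sup>2"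
    using mu'_le_gamma by (intro mult_right_mono) auto
  with G_upper[of "p - x k" k]
  have "(p - x k) \<bullet> G k (p - x k) \<le> 1 / \<gamma> * (norm (p - x k))\<^sup>2" by (rule order_trans)
  then have "1/2 * ((p - x k) \<bullet> G k (p - x k)) \<le> (norm (p - x k))\<^sup>2 / (2 * \<gamma>)" by simp
  then have le_p: "real_model f g (G k) (x k) p \<le> real_model f g prox (x k) p"
    using diff[of p] by linarith
  have q_le_p: "real_model f g (G k) (x k) q \<le> real_model f g (G k) (x k) p"
    using q pd by (simp add: model_minimizer_def)
  have "0 \<le> \<mu> * (norm (q - x k))\<^sup>2" using mu by simp
  then have "0 \<le> (q - x k) \<bullet> G k (q - x k)"
    using G_lower[of "q - x k" k] by linarith
  moreover have "real_model f g prox (x k) p + (norm (q - p))\<^sup>2 / (2 * \<gamma>) \<le> real_model f g prox (x k) q"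
    using model_growth[OF g_proper g_convex linear_scale p qd] by (simp add: power2_norm_eq_inner)
  ultimately have "(norm (q - p))\<^sup>2 / (2 * \<gamma>) \<le> (norm (q - x k))\<^sup>2 / (2 * \<gamma>)"
    using diff[of q] le_p q_le_p by linarith
  then have "(norm (q - p))\<^sup>2 \<le> (norm (q - x k))\<^sup>2"
    using gamma_pos by (simp add: divide_le_cancel)
  then have "norm (q - p) \<le> norm (q - x k)" by (rule power2_le_imp_le) simp
  moreover have "norm (p - x k) \<le> norm (q - x k) + norm (q - p)"
    using norm_triangle_ineq4[of "q - x k" "q - p"] by simp
  ultimately have "norm (p - x k) \<le> 2 * exact_factor * norm (step k)" using qx by simp
  moreover have "real_model f g (G k) (x k) (y k) \<le> real_model f g prox (x k) p + \<epsilon> k * (norm (step k))\<^sup>2"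
    using inexact q_le_p le_p by linarith
  ultimately show thesis using that p by blast
qed

lemma edom_closure: "z \<in> edom g \<Longrightarrow> z \<in> closure (edom g)"
  using closure_subset by blast

section \<open>The potential along the iterates\<close>

text \<open>The point at which the potential is considered in step \<open>k\<close>. The square of its last component is
  the inexactness admitted in this step.\<close>

definition lift :: "nat \<Rightarrow> 'a \<times> 'a \<times> real" where
  "lift k = (x k, y k, sqrt (\<epsilon> k) * norm (step k))"

text \<open>The potential separates consecutive objective values. Below: \<open>Freal (x (Suc k)) \<le> Freal (y k)\<close>, the descent lemma
  bounds \<open>Freal (y k)\<close> by the model value at \<open>y k\<close> plus \<open>L / 2 * (norm (step k))\<^sup>2\<close>, and the model value exceeds the
  envelope by at most the inexactness; these two excesses are precisely what the potential adds to the envelope.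
  Above: the envelope is at most the objective.\<close>

lemma potential_bounds:
  obtains P where "potential f g L \<gamma> (lift k) = ereal P" "Freal (x (Suc k)) \<le> P"
    "P \<le> Freal (x k) + (L / 2 + eps_bound) * (norm (step k))\<^sup>2"
proof -
  obtain p where p: "model_minimizer f g prox (x k) p"
    and le: "real_model f g (G k) (x k) (y k) \<le> real_model f g prox (x k) p + \<epsilon> k * (norm (step k))\<^sup>2"
    by (rule prox_point)
  define P where "P = real_model f g prox (x k) p + L / 2 * (norm (step k))\<^sup>2 + \<epsilon> k * (norm (step k))\<^sup>2"
  have "FBE f g \<gamma> (x k) = ereal (real_model f g prox (x k) p)"
    by (rule FBE_minimizer[OF edom_closure[OF x_edom] f_finite[OF iterates_U(1)] g_proper p])
  then have "potential f g L \<gamma> (lift k) = ereal P"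
    using eps(1) by (simp add: potential_def lift_def P_def power_mult_distrib less_imp_le)
  moreover have "Freal (x (Suc k)) \<le> P"
  proof -
    have "0 \<le> \<mu> * (norm (step k))\<^sup>2" using mu by simp
    then have "0 \<le> step k \<bullet> G k (step k)" using G_lower[of "step k" k] by linarith
    then have "Freal (y k) \<le> real_model f g (G k) (x k) (y k) + L / 2 * (norm (step k))\<^sup>2"
      using f_descent[OF iterates_Gamma(1)[of k] iterates_Gamma(2)[of k]]
      by (simp add: Freal_def real_model_def)
    then show ?thesis using F_le_trial[of k] le unfolding P_def by linarith
  qed
  moreover have "P \<le> Freal (x k) + (L / 2 + eps_bound) * (norm (step k))\<^sup>2"
  proof -
    have "real_model f g prox (x k) p \<le> real_model f g prox (x k) (x k)"
      using p x_edom by (simp add: model_minimizer_def)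
    also have "\<dots> = Freal (x k)" by (simp add: real_model_def Freal_def)
    finally have "real_model f g prox (x k) p \<le> Freal (x k)" .
    moreover have "\<epsilon> k * (norm (step k))\<^sup>2 \<le> eps_bound * (norm (step k))\<^sup>2"
      using eps_le by (intro mult_right_mono) auto
    ultimately show ?thesis unfolding P_def by (simp add: algebra_simps)
  qed
  ultimately show thesis using that by blast
qed

text \<open>The subgradients provided by the expansion of the envelope are small because the proximal point is
  within a multiple of the step length of \<open>x k\<close> and the second derivative of \<open>f\<close> is bounded on the compact set \<open>\<Gamma>\<close>.\<close>

lemma potential_subgradients:
  obtains K where "K > 0"
    "\<And>k. \<exists>v\<in>limiting_subdiff (potential f g L \<gamma>) (lift k). norm v \<le> K * norm (step k)"
proof -
  obtain H :: "'a \<Rightarrow> 'a \<Rightarrow>\<^sub>L 'a" where H: "\<And>z. z \<in> U \<Longrightarrow> (grad f has_derivative blinfun_apply (H z)) (at z)"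
    and contH: "continuous_on U H"
    using U(3) unfolding C2_on_def by blast
  have "compact (H ` \<Gamma>)"
    using contH Gamma(1,4) by (intro compact_continuous_image) (auto intro: continuous_on_subset)
  then obtain B where B: "B > 0" "\<And>z. z \<in> \<Gamma> \<Longrightarrow> norm (H z) \<le> B"
    using compact_imp_bounded[of "H ` \<Gamma>"] by (auto simp: bounded_pos)
  define K where "K = (B + 1 / \<gamma>) * (2 * exact_factor) + 2 * L + 2 * sqrt eps_bound"
  have "0 < (B + 1 / \<gamma>) * (2 * exact_factor)"
    using B exact_factor_pos gamma_pos by (simp add: add_pos_pos)
  then have K: "K > 0" unfolding K_def using L eps_bound_pos by (simp add: add_pos_pos)
  have "\<exists>v\<in>limiting_subdiff (potential f g L \<gamma>) (lift k). norm v \<le> K * norm (step k)" for k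
  proof -
    obtain p where p: "model_minimizer f g prox (x k) p"
      and px: "norm (p - x k) \<le> 2 * exact_factor * norm (step k)"
      by (rule prox_point)
    define w where "w = adjoint (blinfun_apply (H (x k))) (p - x k) + (1 / \<gamma>) *\<^sub>R (x k - p)"
    define t where "t = sqrt (\<epsilon> k) * norm (step k)"
    define v where "v = (w - L *\<^sub>R step k, L *\<^sub>R step k, 2 * t)"
    have xc: "x k \<in> closure (edom g)" by (rule edom_closure[OF x_edom])
    have fin: "\<bar>FBE f g \<gamma> (x k)\<bar> \<noteq> \<infinity>"
      using FBE_minimizer[OF xc f_finite[OF iterates_U(1)] g_proper p] by simp
    have "\<forall>\<^sub>F x' in nhds (x k). FBE f g \<gamma> (x k) + ereal (w \<bullet> (x' - x k) - e * norm (x' - x k))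
        \<le> FBE f g \<gamma> x'" if "e > 0" for e
      unfolding w_def
      by (rule FBE_lower_expansion[OF g_proper g_convex gamma_pos U(1,2) f_finite xc
            f_gderiv[OF iterates_U(1)] H[OF iterates_U(1)] p that])
    then have "v \<in> regular_subdiff (potential f g L \<gamma>) (lift k)"
      unfolding v_def lift_def t_def[symmetric]
      using potential_regular_subgradient[OF fin] L(1) by simp
    then have mem: "v \<in> limiting_subdiff (potential f g L \<gamma>) (lift k)"
      by (rule regular_subdiff_imp_limiting)
    have "norm w \<le> norm (H (x k)) * norm (p - x k) + 1 / \<gamma> * norm (p - x k)"
      unfolding w_def using gamma_pos norm_adjoint_blinfun_le[of "H (x k)" "p - x k"]
      by (intro norm_triangle_le) (simp add: norm_minus_commute)
    also have "\<dots> \<le> (B + 1 / \<gamma>) * norm (p - x k)"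
      using mult_right_mono[OF B(2)[OF iterates_Gamma(1)[of k]], of "norm (p - x k)"]
      by (simp add: distrib_right)
    also have "\<dots> \<le> (B + 1 / \<gamma>) * (2 * exact_factor * norm (step k))"
      using px B gamma_pos by (intro mult_left_mono) (auto simp: add_nonneg_nonneg)
    finally have nw: "norm w \<le> (B + 1 / \<gamma>) * (2 * exact_factor) * norm (step k)" by (simp add: mult_ac)
    have nt: "\<bar>2 * t\<bar> \<le> 2 * sqrt eps_bound * norm (step k)"
      unfolding t_def using eps(1) eps_le[of k] by (simp add: abs_mult less_imp_le mult_right_mono)
    have "norm v \<le> norm (w - L *\<^sub>R step k) + (norm (L *\<^sub>R step k) + norm (2 * t))"
      unfolding v_def by (meson add_left_mono norm_Pair_le order_trans)
    also have "norm (w - L *\<^sub>R step k) \<le> norm w + norm (L *\<^sub>R step k)" by (rule norm_triangle_ineq4)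
    finally have "norm v \<le> K * norm (step k)"
      using nw nt L(1) unfolding K_def by (simp add: distrib_right)
    then show ?thesis using mem by blast
  qed
  with K that show thesis by blast
qed

lemma lift_in_potential_space: "lift k \<in> potential_space"
  using eps(1) by (simp add: lift_def potential_space_def less_imp_le)

section \<open>Cluster points and convergence\<close>

text \<open>The exact minimizers \<open>p k\<close> converge along with the iterates, since \<open>norm (p k - x k)\<close> is at most a multiple of the step
  length, and the subgradients \<open>- \<nabla>f (x k) - G k (p k - x k)\<close> of \<open>g\<close> at \<open>p k\<close> tend to \<open>- \<nabla>f l\<close>. Lower semicontinuity passes the
  subgradient inequality to the limit, which places \<open>l\<close> in the domain of \<open>g\<close>. There continuity of \<open>g\<close>
  identifies the value. The index map \<open>r\<close> need not be monotone; this is convenient in a proof by contradiction.\<close>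

lemma cluster_point:
  assumes r: "filterlim r at_top sequentially" and l: "(\<lambda>n. x (r n)) \<longlonglongrightarrow> l"
  shows cluster_subgradient: "l \<in> edom g"
      "\<And>z. z \<in> edom g \<Longrightarrow> real_of_ereal (g l) + (- grad f l) \<bullet> (z - l) \<le> real_of_ereal (g z)"
    and cluster_value: "Freal l = Flim"
    and cluster_lift: "(\<lambda>n. lift (r n)) \<longlonglongrightarrow> (l, l, 0)"
proof -
  have step0: "(\<lambda>n. norm (step (r n))) \<longlonglongrightarrow> 0"
    using filterlim_compose[OF step_norm_tendsto_0 r] .
  have "x (r n) \<in> closure (edom g)" for n by (rule edom_closure[OF x_edom])
  then have lc: "l \<in> closure (edom g)"
    using closed_sequentially[OF closed_closure _ l] by blast
  then have lU: "l \<in> U" using U(2) by blast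
  have "\<exists>p. model_minimizer f g (G k) (x k) p \<and> norm (p - x k) \<le> exact_factor * norm (step k)" for k
    using exact_minimizer[of k] by metis
  then obtain p where p: "\<And>k. model_minimizer f g (G k) (x k) (p k)"
    and px: "\<And>k. norm (p k - x k) \<le> exact_factor * norm (step k)" by metis
  have px0: "(\<lambda>n. p (r n) - x (r n)) \<longlonglongrightarrow> 0"
  proof (rule tendsto_norm_zero_cancel, rule tendsto_sandwich[OF _ _ tendsto_const])
    show "(\<lambda>n. exact_factor * norm (step (r n))) \<longlonglongrightarrow> 0"
      by (rule tendsto_mult_right_zero[OF step0])
  qed (use px in auto)
  have pl: "(\<lambda>n. p (r n)) \<longlonglongrightarrow> l"
    using tendsto_add[OF px0 l] by simp
  have G0: "(\<lambda>n. G (r n) (p (r n) - x (r n))) \<longlonglongrightarrow> 0"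
  proof (rule tendsto_norm_zero_cancel, rule tendsto_sandwich[OF _ _ tendsto_const])
    show "(\<lambda>n. \<mu>' * norm (p (r n) - x (r n))) \<longlonglongrightarrow> 0"
      by (rule tendsto_mult_right_zero[OF tendsto_norm_zero[OF px0]])
  qed (use G_norm in auto)
  have "isCont (grad f) l"
    using U(3) lU has_derivative_continuous unfolding C2_on_def by blast
  then have grad_lim: "(\<lambda>n. grad f (x (r n))) \<longlonglongrightarrow> grad f l"
    using isCont_tendsto_compose l by blast
  have lim: "(\<lambda>n. real_of_ereal (g z) + (grad f (x (r n)) + G (r n) (p (r n) - x (r n))) \<bullet> (z - p (r n)))
      \<longlonglongrightarrow> real_of_ereal (g z) + (grad f l + 0) \<bullet> (z - l)" for z
    by (intro tendsto_intros grad_lim G0 pl)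
  have g_le: "g l \<le> ereal (real_of_ereal (g z) + (grad f l + 0) \<bullet> (z - l))" if z: "z \<in> edom g" for z
  proof (rule lsc_fun_sequence_bound[OF g_lsc pl lim])
    fix n
    have pd: "p (r n) \<in> edom g" using p by (simp add: model_minimizer_def)
    obtain s where s: "g (p (r n)) = ereal s" using edom_ereal[OF g_proper pd] by blast
    show "g (p (r n)) \<le> ereal (real_of_ereal (g z)
        + (grad f (x (r n)) + G (r n) (p (r n) - x (r n))) \<bullet> (z - p (r n)))"
      using model_minimizer_subgradient[OF g_proper g_convex G_self_adjoint p z, of "r n"] s by simp
  qed
  show ld: "l \<in> edom g"
    using g_le[OF x_edom[of 0]] unfolding edom_def by (cases "g l") auto
  then obtain s where s: "g l = ereal s" using edom_ereal[OF g_proper ld] by blast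
  show "real_of_ereal (g l) + (- grad f l) \<bullet> (z - l) \<le> real_of_ereal (g z)" if "z \<in> edom g" for z
    using g_le[OF that] s by simp
  have "(\<lambda>n. g (x (r n))) \<longlonglongrightarrow> g l"
    by (rule continuous_on_tendsto_compose[OF g_cont l ld]) (simp add: x_edom)
  then have "(\<lambda>n. real_of_ereal (g (x (r n)))) \<longlonglongrightarrow> real_of_ereal (g l)"
    using s by (intro lim_real_of_ereal) simp
  moreover have "isCont (\<lambda>z. real_of_ereal (f z)) l"
    using f_gderiv[OF lU] has_derivative_continuous unfolding gderiv_def by blast
  then have "(\<lambda>n. real_of_ereal (f (x (r n)))) \<longlonglongrightarrow> real_of_ereal (f l)"
    using isCont_tendsto_compose l by blast
  ultimately have "(\<lambda>n. Freal (x (r n))) \<longlonglongrightarrow> Freal l"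
    unfolding Freal_def by (intro tendsto_add)
  then show "Freal l = Flim"
    using filterlim_compose[OF F_tendsto r] LIMSEQ_unique by blast
  have "(\<lambda>n. step (r n)) \<longlonglongrightarrow> 0" using step0 by (rule tendsto_norm_zero_cancel)
  then have yl: "(\<lambda>n. y (r n)) \<longlonglongrightarrow> l" using tendsto_add[OF _ l] by fastforce
  have "(\<lambda>n. sqrt (\<epsilon> (r n)) * norm (step (r n))) \<longlonglongrightarrow> 0"
  proof (rule tendsto_sandwich[OF _ _ tendsto_const])
    show "(\<lambda>n. sqrt eps_bound * norm (step (r n))) \<longlonglongrightarrow> 0"
      by (rule tendsto_mult_right_zero[OF step0])
    show "\<forall>\<^sub>F n in sequentially. sqrt (\<epsilon> (r n)) * norm (step (r n)) \<le> sqrt eps_bound * norm (step (r n))"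
      by (intro always_eventually allI mult_right_mono) (simp_all add: eps_le)
    show "\<forall>\<^sub>F n in sequentially. 0 \<le> sqrt (\<epsilon> (r n)) * norm (step (r n))"
      using eps(1) by (intro always_eventually allI mult_nonneg_nonneg) (simp_all add: less_imp_le)
  qed
  then show "(\<lambda>n. lift (r n)) \<longlonglongrightarrow> (l, l, 0)"
    unfolding lift_def by (intro tendsto_Pair l yl)
qed

text \<open>At a stationary point the proximal point is the point itself, so the envelope equals the objective, and
  \<open>0\<close> is a regular subgradient; in particular the KL property is available there.\<close>

lemma potential_at_cluster_point:
  assumes l: "l \<in> edom g" and F_l: "Freal l = Flim"
    and sub: "\<And>z. z \<in> edom g \<Longrightarrow> real_of_ereal (g l) + (- grad f l) \<bullet> (z - l) \<le> real_of_ereal (g z)"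
  shows "potential f g L \<gamma> (l, l, 0) = ereal Flim"
    and "limiting_subdiff (potential f g L \<gamma>) (l, l, 0) \<noteq> {}"
proof -
  have lc: "l \<in> closure (edom g)" and lU: "l \<in> U"
    using edom_closure edom_U l by auto
  have min: "model_minimizer f g prox l l"
    unfolding model_minimizer_def
  proof (intro conjI ballI l)
    fix z assume "z \<in> edom g"
    moreover have "0 \<le> 1/2 * ((z - l) \<bullet> prox (z - l))" using gamma_pos by simp
    ultimately show "real_model f g prox l l \<le> real_model f g prox l z"
      using sub[of z] unfolding real_model_def by simp
  qed
  have val: "FBE f g \<gamma> l = ereal Flim"
    using FBE_minimizer[OF lc f_finite[OF lU] g_proper min] F_l
    by (simp add: real_model_def Freal_def)
  then show "potential f g L \<gamma> (l, l, 0) = ereal Flim" by (simp add: potential_def)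
  obtain H :: "'a \<Rightarrow> 'a \<Rightarrow>\<^sub>L 'a" where H: "(grad f has_derivative blinfun_apply (H l)) (at l)"
    using U(3) lU unfolding C2_on_def by blast
  have "\<bar>FBE f g \<gamma> l\<bar> \<noteq> \<infinity>" using val by simp
  from potential_regular_subgradient[OF this less_imp_le[OF L(1)]
      FBE_lower_expansion[OF g_proper g_convex gamma_pos U(1,2) f_finite lc f_gderiv[OF lU] H min],
      of l 0]
  show "limiting_subdiff (potential f g L \<gamma>) (l, l, 0) \<noteq> {}"
    using regular_subdiff_imp_limiting by blast
qed

text \<open>A uniform version of the KL inequality along the iterates. If no constant worked, there would be indices tending to
  infinity that violate the bound with constants tending to infinity. A subsequence of these iterates converges
  by compactness, and the KL inequality at its limit bounds the violated constants.\<close>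

lemma value_error_bound:
  assumes KL: "KL_function_on potential_space (potential f g L \<gamma>) \<theta>" and \<theta>: "0 \<le> \<theta>" "\<theta> < 1"
  obtains C N where "C > 0"
    "\<And>k. k \<ge> N \<Longrightarrow> (Freal (x (Suc k)) - Flim) powr \<theta> \<le> C * norm (step k)"
proof -
  have "\<exists>N. \<forall>k\<ge>N. (Freal (x (Suc k)) - Flim) powr \<theta> \<le> real (Suc N) * norm (step k)"
  proof (rule ccontr)
    assume "\<not> ?thesis"
    then have "\<forall>N. \<exists>k\<ge>N. real (Suc N) * norm (step k) < (Freal (x (Suc k)) - Flim) powr \<theta>"
      by (meson not_le)
    then obtain \<kappa> where \<kappa>: "\<And>N. \<kappa> N \<ge> N"
      "\<And>N. real (Suc N) * norm (step (\<kappa> N)) < (Freal (x (Suc (\<kappa> N))) - Flim) powr \<theta>" by metis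
    have "bounded (range (\<lambda>n. x (\<kappa> n)))"
      using compact_imp_bounded[OF Gamma(1)] by (rule bounded_subset) (use iterates_Gamma in auto)
    then obtain l s where s: "strict_mono s" and "((\<lambda>n. x (\<kappa> n)) \<circ> s) \<longlonglongrightarrow> l"
      using bounded_imp_convergent_subsequence by blast
    then have l: "(\<lambda>n. x (\<kappa> (s n))) \<longlonglongrightarrow> l" by (simp add: o_def)
    have sn: "n \<le> s n" for n using s by (rule strict_mono_imp_increasing)
    have r: "filterlim (\<lambda>n. \<kappa> (s n)) at_top sequentially"
      by (rule filterlim_at_top_mono[OF filterlim_ident])
        (use \<kappa>(1) sn order_trans in \<open>blast intro: always_eventually\<close>)
    note cl = cluster_point[OF r l]
    note pot = potential_at_cluster_point[OF cl(1,3,2)]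
    have "\<forall>k. \<exists>P. potential f g L \<gamma> (lift k) = ereal P \<and> Freal (x (Suc k)) \<le> P \<and>
        P \<le> Freal (x k) + (L / 2 + eps_bound) * (norm (step k))\<^sup>2"
      using potential_bounds by metis
    then obtain P where P: "\<And>k. potential f g L \<gamma> (lift k) = ereal (P k)"
      "\<And>k. Freal (x (Suc k)) \<le> P k"
      "\<And>k. P k \<le> Freal (x k) + (L / 2 + eps_bound) * (norm (step k))\<^sup>2" by metis
    have "(\<lambda>k. Freal (x k) + (L / 2 + eps_bound) * (norm (step k))\<^sup>2) \<longlonglongrightarrow>
        Flim + (L / 2 + eps_bound) * 0\<^sup>2"
      by (intro tendsto_intros F_tendsto step_norm_tendsto_0)
    then have upper: "(\<lambda>k. Freal (x k) + (L / 2 + eps_bound) * (norm (step k))\<^sup>2) \<longlonglongrightarrow> Flim"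
      by simp
    have "P \<longlonglongrightarrow> Flim"
      by (rule tendsto_sandwich[OF _ _ LIMSEQ_Suc[OF F_tendsto] upper])
        (rule always_eventually, rule allI, rule P)+
    then have Plim: "(\<lambda>n. P (\<kappa> (s n))) \<longlonglongrightarrow> Flim" using r by (rule filterlim_compose)
    have Pgt: "Flim < P k" for k using Flim_less[of "Suc k"] P(2)[of k] by simp
    obtain K where K: "K > 0" and sub:
      "\<And>k. \<exists>v\<in>limiting_subdiff (potential f g L \<gamma>) (lift k). norm v \<le> K * norm (step k)"
      using potential_subgradients by blast
    from sub obtain v where v: "\<And>k. v k \<in> limiting_subdiff (potential f g L \<gamma>) (lift k)"
      "\<And>k. norm (v k) \<le> K * norm (step k)" by metis
    have "(l, l, 0) \<in> potential_space" by (simp add: potential_space_def)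
    then obtain c where c: "c > 0"
      and ev: "\<forall>\<^sub>F n in sequentially. (P (\<kappa> (s n)) - Flim) powr \<theta> \<le> c * norm (v (\<kappa> (s n)))"
      using KL_inequality[OF KL _ pot(2,1) cl(4) lift_in_potential_space P(1) Plim Pgt v(1) \<theta>(2)] by blast
    obtain n0 :: nat where n0: "c * K \<le> real n0" using real_arch_simple by blast
    from ev eventually_ge_at_top[of n0] have "\<forall>\<^sub>F n in sequentially. False"
    proof eventually_elim
      case (elim n)
      let ?k = "\<kappa> (s n)"
      have "real (Suc (s n)) * norm (step ?k) < (Freal (x (Suc ?k)) - Flim) powr \<theta>" by (rule \<kappa>(2))
      also have "\<dots> \<le> (P ?k - Flim) powr \<theta>"
        using P(2)[of ?k] Flim_less[of "Suc ?k"] \<theta> by (intro powr_mono2) auto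
      also have "\<dots> \<le> c * (K * norm (step ?k))"
        using elim(1) v(2)[of ?k] c by (meson mult_left_mono less_imp_le order_trans)
      also have "\<dots> \<le> real (Suc (s n)) * norm (step ?k)"
      proof -
        have "c * K \<le> real (Suc (s n))" using n0 elim(2) sn[of n] by linarith
        then show ?thesis using mult_right_mono[of "c * K" _ "norm (step ?k)"] by (simp add: mult_ac)
      qed
      finally show False by simp
    qed
    then show False by simp
  qed
  then obtain N where "\<And>k. k \<ge> N \<Longrightarrow> (Freal (x (Suc k)) - Flim) powr \<theta> \<le> real (Suc N) * norm (step k)"
    by blast
  with that[of "real (Suc N)" N] show thesis by simp
qed

lemma convergence_rate:
  assumes KL: "KL_function_on potential_space (potential f g L \<gamma>) \<theta>" and \<theta>: "1/2 \<le> \<theta>" "\<theta> < 1"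
  shows "\<exists>xbar\<in>stationary_points f g. x \<longlonglongrightarrow> xbar \<and>
           (\<exists>\<rho>\<in>{0<..<1}. \<exists>c1>0. \<forall>\<^sub>F k in sequentially.
              (\<theta> = 1/2 \<longrightarrow> norm (x k - xbar) \<le> c1 * \<rho> ^ k) \<and>
              (\<theta> \<in> {1/2<..<1} \<longrightarrow>
                 norm (x k - xbar) \<le> c1 * real k powr ((1 - \<theta>) / (1 - 2 * \<theta>))))"
proof -
  obtain C N where C: "C > 0"
    and err: "\<And>k. k \<ge> N \<Longrightarrow> (Freal (x (Suc k)) - Flim) powr \<theta> \<le> C * norm (step k)"
    using value_error_bound[OF KL] \<theta> by auto
  have "(\<lambda>k. Freal (x k) - Flim) \<longlonglongrightarrow> 0"
    using tendsto_diff[OF F_tendsto tendsto_const, of Flim] by simp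
  then obtain l \<rho> c where l: "x \<longlonglongrightarrow> l" and rate: "\<rho> \<in> {0<..<1}" "c > 0"
    "\<forall>\<^sub>F n in sequentially. (\<theta> = 1/2 \<longrightarrow> norm (x n - l) \<le> c * \<rho> ^ n) \<and>
       (\<theta> \<in> {1/2<..<1} \<longrightarrow> norm (x n - l) \<le> c * real n powr ((1 - \<theta>) / (1 - 2 * \<theta>)))"
    using KL_descent_rates[where a="\<sigma> * step_bound" and C=C and \<theta>=\<theta> and N=N and x=x
        and r="\<lambda>k. Freal (x k) - Flim" and D="\<lambda>k. norm (step k)"]
      sigma_pos step_bound_pos C \<theta> Flim_less F_decrease err x_step by auto
  note cl = cluster_point[OF filterlim_ident l]
  have "- grad f l \<in> limiting_subdiff g l"
    by (rule subgradient_in_limiting_subdiff[OF g_proper cl(1,2)])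
  then have "l \<in> stationary_points f g"
    by (auto simp: stationary_points_def intro!: bexI[of _ "- grad f l"])
  with l rate show ?thesis by blast
qed

end

theorem theorem2:
  fixes f g :: "'a::euclidean_space \<Rightarrow> ereal"
    and U \<Gamma> :: "'a set"
    and \<mu> \<mu>' \<beta> \<sigma> L \<gamma> \<theta> :: real
    and \<epsilon> :: "nat \<Rightarrow> real"
    and G :: "nat \<Rightarrow> 'a \<Rightarrow> 'a"
    and x y :: "nat \<Rightarrow> 'a"
  assumes f_proper: "proper_fun f" and g_proper: "proper_fun g"
    and g_lsc: "lsc_fun g" and g_convex: "convex_fun g"
    and g_cont: "continuous_on (edom g) g"
    and f_lsc: "lsc_fun f"
    and U: "open U" "closure (edom g) \<subseteq> U" "C2_on U f"
    and F_bounded_below: "(INF z. f z + g z) > -\<infinity>"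
    and mu: "\<mu> > 0"
    and beta: "\<beta> \<in> {0<..<1}"
    and sigma: "\<sigma> \<in> {0<..<1/2 * min 1 \<mu>}"
    and eps: "\<forall>k. \<epsilon> k > 0" "bounded (range \<epsilon>)" "\<exists>k0. \<forall>k\<ge>k0. \<epsilon> k \<le> \<mu> / 10"
    and generated: "VMiPG f g \<mu> \<beta> \<sigma> \<epsilon> G x y"
    and x_bounded: "bounded (range x)"
    and mu': "\<mu>' > 0" "\<forall>k. onorm (G k) \<le> \<mu>'"
    and Gamma: "compact \<Gamma>" "convex \<Gamma>" "range x \<union> range y \<subseteq> \<Gamma>" "\<Gamma> \<subseteq> U"
    and L: "L > 0" "L-lipschitz_on \<Gamma> (grad f)"
    and gamma: "\<gamma> \<in> {0<..1 / \<mu>'}"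
    and theta: "\<theta> \<in> {1/2..<1}"
    and KL: "KL_function_on potential_space (potential f g L \<gamma>) \<theta>"
  shows "\<exists>xbar\<in>stationary_points f g. x \<longlonglongrightarrow> xbar \<and>
           (\<exists>\<rho>\<in>{0<..<1}. \<exists>c1>0. \<forall>\<^sub>F k in sequentially.
              (\<theta> = 1/2 \<longrightarrow> norm (x k - xbar) \<le> c1 * \<rho> ^ k) \<and>
              (\<theta> \<in> {1/2<..<1} \<longrightarrow>
                 norm (x k - xbar) \<le> c1 * real k powr ((1 - \<theta>) / (1 - 2 * \<theta>))))"
proof -
  interpret bounded_VMiPG_run f g U \<Gamma> \<mu> \<mu>' \<beta> \<sigma> L \<gamma> \<epsilon> G x y
    by unfold_locales (fact assms)+
  show ?thesis
    using convergence_rate[OF KL] theta by simp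
qed

end
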